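(* Let $(\mathcal{X},d)$ be a Polish metric space and $\mu$ a Borel probability measure on $\mathcal{X}$. For $t\in(0,1/2)$ set $$r_\infty(t):=\sup_{n\ge 1}\mathrm{Obs\,Diam}(\mathcal{X}^n,d_2,\mu^n,t)\in[0,+\infty].$$ Then $\mu$ satisfies the Poincaré inequality with the optimal constant $\lambda>0$ if and only if $r_\infty(t)<\infty$ for some $t\in(0,1/2)$. Moreover, $$\overline{\Phi}^{-1}(t)\le r_\infty(t)\sqrt{\lambda}\le a\log\left(\frac{b}{t}\right),\qquad \forall t\in(0,1/2),$$ where $a>0$ and $b\ge1$ are some universal constants.
   Context: For $n\ge 1$, $\mathcal{X}^n$ carries the distance $d_2(x,y)=\left(\sum_{i=1}^n d(x_i,y_i)^2\right)^{1/2}$ and the product measure $\mu^n$. Poincaré inequality with constant $\lambda$: $\lambda\,\mathrm{Var}_\mu(f)\le\int|\nabla^-f|^2\,d\mu$ for all Lipschitz $f:\mathcal{X}\to\mathbb{R}$, where $|\nabla^-f|(x)=\limsup_{y\to x}\frac{[f(y)-f(x)]_-}{d(y,x)}$ if $x$ is not isolated ($[u]_-=\max(-u,0)$) and $|\nabla^-f|(x)=0$ if $x$ is isolated. The optimal constant is the largest $\lambda$ for which the inequality holds. The constant $\lambda=+\infty$ is allowed, with the convention $\infty\times 0=0$; it corresponds exactly to $\mu$ being a Dirac measure. For a metric space $(Y,\rho)$ with a Borel probability measure $\nu$ and $t\in[0,1]$, the partial diameter $\mathrm{Part\,Diam}(Y,\rho,\nu,t)$ is the infimum of the diameters of all subsets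 $A\subset Y$ with $\nu(A)\ge 1-t$. The observable diameter is $$\mathrm{Obs\,Diam}(Y,\rho,\nu,t)=\sup_{f}\mathrm{Part\,Diam}(\mathbb{R},|\cdot|,\nu_f,t)\in[0,+\infty],$$ where the supremum is over all $1$-Lipschitz $f:Y\to\mathbb{R}$ and $\nu_f$ is the push-forward of $\nu$ under $f$. $\overline{\Phi}(x)=\frac{1}{\sqrt{2\pi}}\int_x^{+\infty}e^{-u^2/2}\,du$ and $\overline{\Phi}^{-1}$ is its inverse.
   Formalization: The lower bound is stated only for finite λ, since it fails for Dirac measures (λ=∞, r_∞=0, ∞·0=0); a and b are universal over spaces carried by one type, and the case of sets of reals covers all Polish spaces up to isometry. *)

theory Defs
  imports "HOL-Analysis.Analysis" "HOL-Probability.Probability"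
begin

text \<open>
  Spaces are elements of the library type \<^typ>\<open>'a metric\<close> (a carrier set with a metric on it),
  not instances of a type class, so that a statement can quantify over them after quantifying over
  numerical constants. Every Polish metric space has at most continuum many points, hence is
  isometric to some \<^typ>\<open>real metric\<close>; thus constants obtained for \<^typ>\<open>real metric\<close> serve
  all Polish metric spaces.
\<close>

definition polish_metric :: "'a metric \<Rightarrow> bool" where
  "polish_metric m \<longleftrightarrow> mcomplete_of m \<and> separable_space (mtopology_of m)"

definition borel_prob_measure :: "'a metric \<Rightarrow> 'a measure \<Rightarrow> bool" where
  "borel_prob_measure m \<mu> \<longleftrightarrow>
     prob_space \<mu> \<and> sets \<mu> = sigma_sets (mspace m) {U. openin (mtopology_of m) U}"

definition isolated_point :: "'a metric \<Rightarrow> 'a \<Rightarrow> bool" where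
  "isolated_point m x \<longleftrightarrow> openin (mtopology_of m) {x}"

definition grad_minus :: "'a metric \<Rightarrow> ('a \<Rightarrow> real) \<Rightarrow> 'a \<Rightarrow> ennreal" where
  "grad_minus m f x =
     (if isolated_point m x then 0
      else Limsup (atin (mtopology_of m) x)
             (\<lambda>y. ennreal (max (- (f y - f x)) 0 / mdist m y x)))"

text \<open>A Lipschitz function need not be square integrable; its variance is then \<open>\<infinity>\<close>.\<close>

definition evariance :: "'a measure \<Rightarrow> ('a \<Rightarrow> real) \<Rightarrow> ennreal" where
  "evariance \<mu> f =
     (if integrable \<mu> f then \<integral>\<^sup>+x. ennreal ((f x - (\<integral>y. f y \<partial>\<mu>))\<^sup>2) \<partial>\<mu> else \<infinity>)"

text \<open>In \<^typ>\<open>ennreal\<close> one has \<open>\<infinity> * 0 = 0\<close>.\<close>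

definition poincare :: "'a metric \<Rightarrow> 'a measure \<Rightarrow> ennreal \<Rightarrow> bool" where
  "poincare m \<mu> c \<longleftrightarrow>
     (\<forall>f. Lipschitz_continuous_map m euclidean_metric f \<longrightarrow>
        c * evariance \<mu> f \<le> (\<integral>\<^sup>+x. (grad_minus m f x)\<^sup>2 \<partial>\<mu>))"

definition optimal_poincare :: "'a metric \<Rightarrow> 'a measure \<Rightarrow> ennreal \<Rightarrow> bool" where
  "optimal_poincare m \<mu> c \<longleftrightarrow> poincare m \<mu> c \<and> (\<forall>c'. poincare m \<mu> c' \<longrightarrow> c' \<le> c)"

definition power_metric :: "nat \<Rightarrow> 'a metric \<Rightarrow> (nat \<Rightarrow> 'a) metric" where
  "power_metric n m =
     metric (PiE {1..n} (\<lambda>_. mspace m), \<lambda>x y. sqrt (\<Sum>i\<in>{1..n}. (mdist m (x i) (y i))\<^sup>2))"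

text \<open>
  \<^const>\<open>metric\<close> is only meaningful on pairs that form a metric space, and a metric there has
  to be nonnegative and symmetric on the whole type, not just on the carrier.
\<close>

lemma Metric_space_power:
  fixes m :: "'a metric" and n :: nat
  shows "Metric_space (PiE {1..n} (\<lambda>_. mspace m))
     (\<lambda>x y. sqrt (\<Sum>i\<in>{1..n}. (mdist m (x i) (y i))\<^sup>2))"
proof
  fix x y :: "nat \<Rightarrow> 'a"
  show "0 \<le> sqrt (\<Sum>i\<in>{1..n}. (mdist m (x i) (y i))\<^sup>2)"
    by (simp add: sum_nonneg)
  show "sqrt (\<Sum>i\<in>{1..n}. (mdist m (x i) (y i))\<^sup>2) = sqrt (\<Sum>i\<in>{1..n}. (mdist m (y i) (x i))\<^sup>2)"
    by (simp add: mdist_commute)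
next
  fix x y assume x: "x \<in> PiE {1..n} (\<lambda>_. mspace m)" and y: "y \<in> PiE {1..n} (\<lambda>_. mspace m)"
  have "sqrt (\<Sum>i\<in>{1..n}. (mdist m (x i) (y i))\<^sup>2) = 0 \<longleftrightarrow> (\<forall>i\<in>{1..n}. mdist m (x i) (y i) = 0)"
    by (simp add: sum_nonneg_eq_0_iff)
  also have "\<dots> \<longleftrightarrow> (\<forall>i\<in>{1..n}. x i = y i)"
    using x y by (intro ball_cong refl mdist_zero) (auto simp: PiE_iff)
  also have "\<dots> \<longleftrightarrow> x = y"
    using x y by (auto intro: PiE_ext[OF x y])
  finally show "(sqrt (\<Sum>i\<in>{1..n}. (mdist m (x i) (y i))\<^sup>2) = 0) = (x = y)" .
next
  fix x y z
  assume x: "x \<in> PiE {1..n} (\<lambda>_. mspace m)" and y: "y \<in> PiE {1..n} (\<lambda>_. mspace m)"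
    and z: "z \<in> PiE {1..n} (\<lambda>_. mspace m)"
  have "L2_set (\<lambda>i. mdist m (x i) (z i)) {1..n}
        \<le> L2_set (\<lambda>i. mdist m (x i) (y i) + mdist m (y i) (z i)) {1..n}"
    using x y z by (intro L2_set_mono mdist_triangle) (auto simp: PiE_iff)
  also have "\<dots> \<le> L2_set (\<lambda>i. mdist m (x i) (y i)) {1..n} + L2_set (\<lambda>i. mdist m (y i) (z i)) {1..n}"
    by (rule L2_set_triangle_ineq)
  finally show "sqrt (\<Sum>i\<in>{1..n}. (mdist m (x i) (z i))\<^sup>2)
     \<le> sqrt (\<Sum>i\<in>{1..n}. (mdist m (x i) (y i))\<^sup>2) + sqrt (\<Sum>i\<in>{1..n}. (mdist m (y i) (z i))\<^sup>2)"
    by (simp add: L2_set_def)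
qed

lemma mspace_power_metric [simp]:
  "mspace (power_metric n m) = PiE {1..n} (\<lambda>_. mspace m)"
  unfolding power_metric_def by (rule Metric_space.mspace_metric[OF Metric_space_power])

lemma mdist_power_metric [simp]:
  "mdist (power_metric n m) x y = sqrt (\<Sum>i\<in>{1..n}. (mdist m (x i) (y i))\<^sup>2)"
  unfolding power_metric_def by (simp only: Metric_space.mdist_metric[OF Metric_space_power])

text \<open>Extended-valued, unlike the library's \<^const>\<open>diameter\<close>.\<close>

definition ediam :: "'b metric \<Rightarrow> 'b set \<Rightarrow> ennreal" where
  "ediam m A = (SUP x\<in>A. SUP y\<in>A. ennreal (mdist m x y))"

definition part_diam :: "'b metric \<Rightarrow> 'b measure \<Rightarrow> real \<Rightarrow> ennreal" where
  "part_diam m \<nu> t =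
     (INF A\<in>{A. A \<subseteq> mspace m \<and> A \<in> sets \<nu> \<and> measure \<nu> A \<ge> 1 - t}. ediam m A)"

definition obs_diam :: "'b metric \<Rightarrow> 'b measure \<Rightarrow> real \<Rightarrow> ennreal" where
  "obs_diam m \<nu> t =
     (SUP f\<in>{f. \<forall>x\<in>mspace m. \<forall>y\<in>mspace m. \<bar>f x - f y\<bar> \<le> mdist m x y}.
        part_diam (euclidean_metric :: real metric) (distr \<nu> borel f) t)"

definition r_infty :: "'a metric \<Rightarrow> 'a measure \<Rightarrow> real \<Rightarrow> ennreal" where
  "r_infty m \<mu> t = (SUP n\<in>{1..}. obs_diam (power_metric n m) (PiM {1..n} (\<lambda>_. \<mu>)) t)"

definition Phi_bar :: "real \<Rightarrow> real" where
  "Phi_bar x = 1 / sqrt (2 * pi) * (LBINT u:{x..}. exp (- (u\<^sup>2) / 2))"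

definition esqrt :: "ennreal \<Rightarrow> ennreal" where
  "esqrt c = (if c = \<infinity> then \<infinity> else ennreal (sqrt (enn2real c)))"

end

theory Submission
  imports Defs
begin

text \<open>
  The two halves of the statement have different reasons.

  \<^bold>\<open>From the Poincare inequality to concentration.\<close> The variance of a function of several independent
  variables is at most the sum of the mean variances in each variable (\<open>tensorization\<close>), so a Poincare
  inequality for \<open>\<mu>\<close> with constant \<open>c\<close> bounds variances on \<open>X\<^sup>n\<close> by the integral of the sum of the squared
  partial slopes. For a function \<open>f\<close> that is 1-Lipschitz for \<open>d\<^sub>2\<close> this sum can exceed 1: at \<open>x\<^sub>0\<close>, the partial
  descending slope of \<open>x \<mapsto> - d\<^sub>2(x, x\<^sub>0)\<close> is 1 in every coordinate that is not isolated. One therefore passes to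
  the sup-convolution \<open>g(x) = sup\<^sub>y f(y) - sqrt (\<delta>\<^sup>2 + d\<^sub>2(x,y)\<^sup>2)\<close>. It differs from \<open>f\<close> by at most \<open>\<delta>\<close>,
  and a single near-maximiser \<open>y\<close> controls all partial slopes of \<open>g\<close> at \<open>x\<close> at once, so the sum of their
  squares is at most 1 (\<open>sum_grad_minus_sup_conv_le_1\<close>). Cut \<open>g\<close> off below a level \<open>b\<close> with
  \<open>P(g \<le> b) \<ge> 1/2\<close> and above \<open>b + R\<close>. The truncation has variance at least \<open>R\<^sup>2 P(g > b + R) / 2\<close>,
  while its slopes vanish outside \<open>{b < g \<le> b + R}\<close>. With \<open>R = sqrt (2/c)\<close> the inequality
  becomes \<open>2 P(g > b + R) \<le> P(g > b)\<close> (\<open>tail_halving\<close>): starting at a median, the tail halves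
  every \<open>R\<close>, and this exponential decay is the logarithmic upper bound (\<open>r_infty_le\<close>).

  \<^bold>\<open>From concentration to the Poincare inequality.\<close> If the observable diameters of all powers are below \<open>r\<close>,
  then a set of measure at least \<open>1/2\<close> in \<open>X\<^sup>n\<close> has an \<open>r\<close>-neighbourhood of measure at least \<open>1 - t\<close>
  (\<open>obs_diam_enlargement\<close>). Take a bounded Lipschitz \<open>f\<close> of mean 0 and variance \<open>\<sigma>\<^sup>2\<close>, and the set where
  \<open>\<Sum>f(y\<^sub>i) \<le> \<eta> sqrt n\<close>. With \<open>s = \<theta> / sqrt n\<close> and \<open>G\<close> the descending slope of \<open>f\<close> at a small scale,
  \<open>f(x\<^sub>i) \<le> f(y\<^sub>i) + s G(x\<^sub>i)\<^sup>2 / 2 + d(x\<^sub>i,y\<^sub>i)\<^sup>2 / (2 s)\<close>. Summation over \<open>i\<close> shows that with probability at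
  least \<open>1 - t\<close>
  \<open>\<Sum>f(x\<^sub>i) / sqrt n \<le> \<eta> + (\<theta>/2) (\<Sum>G(x\<^sub>i)\<^sup>2) / n + r\<^sup>2 / (2 \<theta>)\<close>.
  By the central limit theorem the left side is asymptotically Gaussian with variance \<open>\<sigma>\<^sup>2\<close>, and by the law of
  large numbers the mean of the \<open>G\<^sup>2\<close> tends to \<open>\<integral>G\<^sup>2\<close>. In the limit
  \<open>\<sigma> q \<le> r\<^sup>2 / (2 \<theta>) + (\<theta>/2) \<integral>G\<^sup>2\<close> with \<open>q\<close> the Gaussian quantile of \<open>t\<close> (\<open>variance_le_at_scale\<close>).
  Letting the scale tend to 0 and optimising over \<open>\<theta>\<close> gives the Poincare inequality with constant
  \<open>(q/r)\<^sup>2\<close>, which is both the missing implication and the lower bound on \<open>r\<close>.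

  The optimal constant is the supremum of all admissible ones and always exists, possibly 0 or \<open>\<infinity>\<close>
  (\<open>optimal_poincare_exists\<close>).
\<close>

section \<open>Descending slopes and measurability\<close>

text \<open>
  The supremum in place of the limit superior that defines \<^const>\<open>grad_minus\<close>, at a fixed scale.
\<close>

definition descent_slope :: "'a metric \<Rightarrow> ('a \<Rightarrow> real) \<Rightarrow> real \<Rightarrow> 'a \<Rightarrow> ennreal" where
  "descent_slope m f \<rho> x =
     (SUP y\<in>{y\<in>mspace m. 0 < mdist m y x \<and> mdist m y x < \<rho>}.
        ennreal (max (f x - f y) 0 / mdist m y x))"

lemma descent_slope_mono:
  "\<rho> \<le> \<rho>' \<Longrightarrow> descent_slope m f \<rho> x \<le> descent_slope m f \<rho>' x"
  unfolding descent_slope_def by (intro SUP_subset_mono) auto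

lemma descent_slope_le:
  assumes "\<And>y. y \<in> mspace m \<Longrightarrow> mdist m y x < \<rho> \<Longrightarrow> f x - f y \<le> L * mdist m y x" "0 \<le> L"
  shows "descent_slope m f \<rho> x \<le> ennreal L"
  unfolding descent_slope_def
proof (intro SUP_least ennreal_leI)
  fix y assume y: "y \<in> {y \<in> mspace m. 0 < mdist m y x \<and> mdist m y x < \<rho>}"
  then show "max (f x - f y) 0 / mdist m y x \<le> L"
    using assms by (simp add: divide_le_eq)
qed

text \<open>
  The case distinction in the definition of \<^const>\<open>grad_minus\<close> disappears: at an isolated point the slopes at
  small scales are suprema over the empty set, hence 0.
\<close>

lemma grad_minus_eq_INF_descent_slope:
  assumes x: "x \<in> mspace m"
  shows "grad_minus m f x = (INF k. descent_slope m f (1 / real (Suc k)) x)"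
proof -
  interpret Metric_space "mspace m" "mdist m" by (rule Metric_space_mspace_mdist)
  have top: "mtopology_of m = mtopology" by (simp add: mtopology_of_def)
  define u where "u y = ennreal (max (f x - f y) 0 / mdist m y x)" for y
  have slope: "descent_slope m f \<rho> x = Sup (u ` {y\<in>mspace m. 0 < mdist m y x \<and> mdist m y x < \<rho>})" for \<rho>
    by (simp add: descent_slope_def u_def)
  show ?thesis
  proof (cases "isolated_point m x")
    case True
    then have "openin mtopology {x}" by (simp add: isolated_point_def top)
    then obtain r where r: "r > 0" "mball x r \<subseteq> {x}"
      by (auto simp: openin_mtopology)
    obtain k where k: "1 / real (Suc k) < r"
      using nat_approx_posE[OF \<open>r > 0\<close>] by blast
    have "{y\<in>mspace m. 0 < mdist m y x \<and> mdist m y x < 1 / real (Suc k)} = {}"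
    proof (rule ccontr)
      assume "\<not> ?thesis"
      then obtain y where y: "y \<in> mspace m" "0 < mdist m y x" "mdist m y x < 1 / real (Suc k)"
        by blast
      then have "y \<in> mball x r" using k x by (simp add: mdist_commute)
      with r have "y = x" by auto
      with y x show False by simp
    qed
    then have "descent_slope m f (1 / real (Suc k)) x = 0"
      by (simp only: slope) (simp add: bot_ennreal)
    then have "(INF k. descent_slope m f (1 / real (Suc k)) x) \<le> 0"
      by (metis INF_lower UNIV_I)
    with True show ?thesis by (simp add: grad_minus_def)
  next
    case False
    have "Limsup (atin mtopology x) u = (INF k. descent_slope m f (1 / real (Suc k)) x)"
    proof (rule antisym)
      show "Limsup (atin mtopology x) u \<le> (INF k. descent_slope m f (1 / real (Suc k)) x)"
      proof (rule INF_greatest)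
        fix k
        show "Limsup (atin mtopology x) u \<le> descent_slope m f (1 / real (Suc k)) x"
          unfolding Limsup_def slope
          by (intro INF_lower2[of "\<lambda>y. y\<in>mspace m \<and> 0 < mdist m y x \<and> mdist m y x < 1 / real (Suc k)"])
             (auto simp: eventually_atin_metric intro!: exI[of _ "1 / real (Suc k)"])
      qed
      show "(INF k. descent_slope m f (1 / real (Suc k)) x) \<le> Limsup (atin mtopology x) u"
        unfolding Limsup_def
      proof (rule INF_greatest)
        fix P assume "P \<in> {P. eventually P (atin mtopology x)}"
        then obtain \<delta> where \<delta>: "\<delta> > 0" "\<And>y. y \<in> mspace m \<Longrightarrow> 0 < mdist m y x \<Longrightarrow> mdist m y x < \<delta> \<Longrightarrow> P y"
          using x by (auto simp: eventually_atin_metric)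
        obtain k where k: "1 / real (Suc k) < \<delta>"
          using nat_approx_posE[OF \<open>\<delta> > 0\<close>] by blast
        have "descent_slope m f (1 / real (Suc k)) x \<le> Sup (u ` {x. P x})"
          unfolding slope by (intro SUP_subset_mono) (use \<delta> k in auto)
        then show "(INF k. descent_slope m f (1 / real (Suc k)) x) \<le> Sup (u ` {x. P x})"
          by (meson INF_lower2 UNIV_I)
      qed
    qed
    with False show ?thesis by (simp add: grad_minus_def u_def[abs_def] top)
  qed
qed

corollary grad_minus_le_descent_slope:
  assumes "x \<in> mspace m" "\<rho> > 0"
  shows "grad_minus m f x \<le> descent_slope m f \<rho> x"
proof -
  obtain k where k: "1 / real (Suc k) < \<rho>"
    using nat_approx_posE[OF \<open>\<rho> > 0\<close>] by blast
  have "grad_minus m f x \<le> descent_slope m f (1 / real (Suc k)) x"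
    unfolding grad_minus_eq_INF_descent_slope[OF assms(1)] by (rule INF_lower) simp
  also have "\<dots> \<le> descent_slope m f \<rho> x" using k by (intro descent_slope_mono) simp
  finally show ?thesis .
qed

text \<open>
  For a continuous function, points of a dense set suffice in the supremum. This makes slopes countable
  suprema of measurable functions, even where the base point is one coordinate of a point in a power.
\<close>

lemma descent_slope_countable:
  assumes x: "x \<in> mspace m" and D: "D \<subseteq> mspace m"
    and dense: "\<And>y e. y \<in> mspace m \<Longrightarrow> e > 0 \<Longrightarrow> \<exists>z\<in>D. mdist m y z < e"
    and lip: "\<And>y z. y \<in> mspace m \<Longrightarrow> z \<in> mspace m \<Longrightarrow> \<bar>f y - f z\<bar> \<le> L * mdist m y z"
  shows "descent_slope m f \<rho> x =
    (SUP y\<in>D. if 0 < mdist m y x \<and> mdist m y x < \<rho>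
       then ennreal (max (f x - f y) 0 / mdist m y x) else 0)" (is "_ = ?S")
proof (rule antisym)
  show "?S \<le> descent_slope m f \<rho> x"
    unfolding descent_slope_def using D by (intro SUP_least) (auto intro!: SUP_upper2)
  show "descent_slope m f \<rho> x \<le> ?S"
    unfolding descent_slope_def
  proof (rule SUP_least, clarify)
    fix y assume y: "y \<in> mspace m" "0 < mdist m y x" "mdist m y x < \<rho>"
    have "\<exists>z\<in>D. mdist m y z < 1 / real (Suc n)" for n
      by (rule dense[OF y(1)]) simp
    then obtain z where z: "\<And>n. z n \<in> D" "\<And>n. mdist m y (z n) < 1 / real (Suc n)"
      by metis
    have zm: "z n \<in> mspace m" for n using z(1) D by auto
    have lim0: "(\<lambda>n. mdist m y (z n)) \<longlonglongrightarrow> 0"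
      by (rule tendsto_sandwich[OF _ _ tendsto_const LIMSEQ_inverse_real_of_nat])
         (use z(2) in \<open>auto intro!: always_eventually simp: inverse_eq_divide less_imp_le\<close>)
    have "\<bar>mdist m (z n) x - mdist m y x\<bar> \<le> mdist m y (z n)" for n
      using mdist_triangle[OF zm[of n] y(1) x] mdist_triangle[OF y(1) zm[of n] x]
      by (simp add: mdist_commute)
    then have limd: "(\<lambda>n. mdist m (z n) x) \<longlonglongrightarrow> mdist m y x"
      by (intro LIM_zero_cancel[OF Lim_null_comparison[OF always_eventually lim0]]) simp
    have "\<bar>f (z n) - f y\<bar> \<le> L * mdist m y (z n)" for n
      using lip[OF zm[of n] y(1)] by (simp add: mdist_commute)
    then have limf: "(\<lambda>n. f (z n)) \<longlonglongrightarrow> f y"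
      by (intro LIM_zero_cancel[OF Lim_null_comparison[OF always_eventually
            tendsto_mult_right_zero[OF lim0, of L]]]) simp
    have "(\<lambda>n. ennreal (max (f x - f (z n)) 0 / mdist m (z n) x)) \<longlonglongrightarrow>
        ennreal (max (f x - f y) 0 / mdist m y x)"
      using y by (intro tendsto_ennrealI tendsto_divide tendsto_max tendsto_diff tendsto_const limf limd) simp
    moreover have "\<forall>\<^sub>F n in sequentially. ennreal (max (f x - f (z n)) 0 / mdist m (z n) x) \<le> ?S"
      using order_tendstoD(1)[OF limd y(2)] order_tendstoD(2)[OF limd y(3)]
    proof eventually_elim
      case (elim n)
      then show ?case by (intro SUP_upper2[OF z(1)[of n]]) simp
    qed
    ultimately show "ennreal (max (f x - f y) 0 / mdist m y x) \<le> ?S"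
      by (rule tendsto_upperbound) simp
  qed
qed

text \<open>
  A Lipschitz function is the infimum of the cones \<open>f y + L d(\<cdot>, y)\<close> over a countable dense set of \<open>y\<close>
  (McShane). So it is measurable for every sigma-algebra that makes the distances to these points
  measurable; on a power this avoids comparing the product sigma-algebra with the Borel sets of \<open>d\<^sub>2\<close>.
\<close>

lemma borel_measurable_lipschitz_dense:
  fixes f :: "'b \<Rightarrow> real"
  assumes D: "countable D"
    and meas: "\<And>y. y \<in> D \<Longrightarrow> (\<lambda>x. d x y) \<in> borel_measurable N"
    and nonneg: "\<And>x y. 0 \<le> d x y"
    and dense: "\<And>x e. x \<in> space N \<Longrightarrow> e > 0 \<Longrightarrow> \<exists>y\<in>D. d x y < e"
    and lip: "\<And>x y. x \<in> space N \<Longrightarrow> y \<in> D \<Longrightarrow> \<bar>f x - f y\<bar> \<le> L * d x y" and L: "0 \<le> L"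
  shows "f \<in> borel_measurable N"
proof -
  define g where "g x = (INF y\<in>D. f y + L * d x y)" for x
  have "g \<in> borel_measurable N"
    unfolding g_def using D meas by measurable
  moreover have "f x = g x" if x: "x \<in> space N" for x
  proof (rule antisym)
    have ne: "D \<noteq> {}" using dense[OF x, of 1] by auto
    have low: "f x \<le> f y + L * d x y" if "y \<in> D" for y using lip[OF x that] by simp
    then show "f x \<le> g x"
      unfolding g_def using ne by (intro cINF_greatest) auto
    show "g x \<le> f x"
    proof (rule field_le_epsilon)
      fix e :: real assume e: "e > 0"
      then obtain y where y: "y \<in> D" "d x y < e / (2 * L + 1)"
        using dense[OF x, of "e / (2 * L + 1)"] L by auto
      have "g x \<le> f y + L * d x y"
        unfolding g_def using y low by (intro cINF_lower bdd_belowI2) auto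
      also have "\<dots> \<le> f x + 2 * (L * d x y)" using lip[OF x y(1)] by simp
      also have "\<dots> \<le> f x + (2 * L + 1) * d x y"
        using nonneg[of x y] by (simp add: algebra_simps)
      also have "(2 * L + 1) * d x y \<le> e" using y L by (simp add: field_simps)
      finally show "g x \<le> f x + e" by simp
    qed
  qed
  ultimately show ?thesis by (subst measurable_cong)
qed

locale polish_prob =
  fixes m :: "'a metric" and \<mu> :: "'a measure"
  assumes polish: "polish_metric m" and borel_prob: "borel_prob_measure m \<mu>"
begin

sublocale prob_space \<mu>
  using borel_prob by (simp add: borel_prob_measure_def)

lemma space_eq [simp]: "space \<mu> = mspace m"
proof -
  have s: "sets \<mu> = sigma_sets (mspace m) {U. openin (mtopology_of m) U}"
    using borel_prob by (simp add: borel_prob_measure_def)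
  have "{U. openin (mtopology_of m) U} \<subseteq> Pow (mspace m)"
    using openin_subset by fastforce
  then have "sets \<mu> = sets (sigma (mspace m) {U. openin (mtopology_of m) U})"
    using s by simp
  from sets_eq_imp_space_eq[OF this] show ?thesis by (simp add: space_measure_of_conv)
qed

sublocale power: product_prob_space "\<lambda>_. \<mu>" "I :: 'i set" for I ..

lemma space_power [simp]: "space (PiM I (\<lambda>_. \<mu>)) = PiE I (\<lambda>_. mspace m)"
  by (simp add: space_PiM)

definition dense_set :: "'a set" where
  "dense_set = (SOME C. countable C \<and> C \<subseteq> mspace m \<and> mtopology_of m closure_of C = mspace m)"

lemma dense_set:
  shows countable_dense_set: "countable dense_set" and dense_set_subset: "dense_set \<subseteq> mspace m"
    and dense_set_dense: "\<And>x e. x \<in> mspace m \<Longrightarrow> e > 0 \<Longrightarrow> \<exists>y\<in>dense_set. mdist m x y < e"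
proof -
  interpret Metric_space "mspace m" "mdist m" by (rule Metric_space_mspace_mdist)
  have "\<exists>C. countable C \<and> C \<subseteq> mspace m \<and> mtopology_of m closure_of C = mspace m"
    using polish by (simp add: polish_metric_def separable_space_def)
  from someI_ex[OF this] have *: "countable dense_set \<and> dense_set \<subseteq> mspace m
      \<and> mtopology_of m closure_of dense_set = mspace m"
    unfolding dense_set_def .
  then show "countable dense_set" "dense_set \<subseteq> mspace m" by auto
  fix x and e :: real assume "x \<in> mspace m" "e > 0"
  then have "x \<in> mtopology closure_of dense_set" using * by (simp add: mtopology_of_def)
  then obtain y where "y \<in> dense_set" "y \<in> mball x e"
    using \<open>e > 0\<close> by (auto simp: metric_closure_of)
  then show "\<exists>y\<in>dense_set. mdist m x y < e" by auto
qed

lemma measurable_mdist [measurable]: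
  assumes y: "y \<in> mspace m" shows "(\<lambda>x. mdist m x y) \<in> borel_measurable \<mu>"
proof (rule borel_measurableI_less)
  fix a
  interpret Metric_space "mspace m" "mdist m" by (rule Metric_space_mspace_mdist)
  have "{x \<in> space \<mu>. mdist m x y < a} = mball y a"
    using y by (auto simp: mdist_commute)
  moreover have "openin (mtopology_of m) (mball y a)" by (simp add: mtopology_of_def)
  ultimately show "{x \<in> space \<mu>. mdist m x y < a} \<in> sets \<mu>"
    using borel_prob by (auto simp: borel_prob_measure_def intro!: sigma_sets.Basic)
qed

lemma measurable_mdist' [measurable]:
  assumes y: "y \<in> mspace m" shows "(\<lambda>x. mdist m y x) \<in> borel_measurable \<mu>"
  using measurable_mdist[OF y] by (simp add: mdist_commute[of m y])

abbreviation pdist :: "'i set \<Rightarrow> ('i \<Rightarrow> 'a) \<Rightarrow> ('i \<Rightarrow> 'a) \<Rightarrow> real" where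
  "pdist I x y \<equiv> L2_set (\<lambda>i. mdist m (x i) (y i)) I"

lemma borel_measurable_lipschitz:
  fixes f :: "'a \<Rightarrow> real"
  assumes lip: "\<And>x y. x \<in> mspace m \<Longrightarrow> y \<in> mspace m \<Longrightarrow> \<bar>f x - f y\<bar> \<le> L * mdist m x y" and "0 \<le> L"
  shows "f \<in> borel_measurable \<mu>"
proof (rule borel_measurable_lipschitz_dense[OF countable_dense_set, where d = "mdist m" and L = L])
  show "(\<lambda>x. mdist m x y) \<in> borel_measurable \<mu>" if "y \<in> dense_set" for y
    using that dense_set_subset by (intro measurable_mdist) auto
  show "\<exists>y\<in>dense_set. mdist m x y < e" if "x \<in> space \<mu>" "e > 0" for x e
    using that dense_set_dense by simp
  show "\<bar>f x - f y\<bar> \<le> L * mdist m x y" if "x \<in> space \<mu>" "y \<in> dense_set" for x y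
    using that dense_set_subset by (intro lip) auto
qed (use \<open>0 \<le> L\<close> in simp_all)

lemma borel_measurable_lipschitz_power:
  fixes f :: "('i \<Rightarrow> 'a) \<Rightarrow> real"
  assumes I: "finite I"
    and lip: "\<And>x y. x \<in> PiE I (\<lambda>_. mspace m) \<Longrightarrow> y \<in> PiE I (\<lambda>_. mspace m) \<Longrightarrow>
      \<bar>f x - f y\<bar> \<le> L * pdist I x y" and "0 \<le> L"
  shows "f \<in> borel_measurable (PiM I (\<lambda>_. \<mu>))"
proof (rule borel_measurable_lipschitz_dense[where d = "pdist I" and L = L])
  let ?D = "PiE I (\<lambda>_. dense_set)"
  have D: "?D \<subseteq> PiE I (\<lambda>_. mspace m)" using dense_set_subset by (intro PiE_mono)
  show "countable ?D" using I countable_dense_set by (intro countable_PiE)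
  show "0 \<le> pdist I x y" for x y by (simp add: L2_set_nonneg)
  show "(\<lambda>x. pdist I x y) \<in> borel_measurable (PiM I (\<lambda>_. \<mu>))" if "y \<in> ?D" for y
  proof -
    have [measurable]: "(\<lambda>x. mdist m x (y i)) \<in> borel_measurable \<mu>" if "i \<in> I" for i
      using that \<open>y \<in> ?D\<close> dense_set_subset by (intro measurable_mdist) (auto simp: PiE_iff)
    show ?thesis unfolding L2_set_def by measurable
  qed
  show "\<bar>f x - f y\<bar> \<le> L * pdist I x y" if "x \<in> space (PiM I (\<lambda>_. \<mu>))" "y \<in> ?D" for x y
    using that D by (intro lip) auto
  show "\<exists>y\<in>?D. pdist I x y < e" if x: "x \<in> space (PiM I (\<lambda>_. \<mu>))" and e: "e > 0" for x e
  proof -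
    define e' where "e' = e / (real (card I) + 1)"
    have e': "e' > 0" using e by (simp add: e'_def)
    have "\<forall>i\<in>I. \<exists>z\<in>dense_set. mdist m (x i) z < e'"
      using x e' by (intro ballI dense_set_dense) (auto simp: PiE_iff)
    then obtain z where z: "\<And>i. i \<in> I \<Longrightarrow> z i \<in> dense_set \<and> mdist m (x i) (z i) < e'"
      by metis
    have "pdist I x (restrict z I) \<le> (\<Sum>i\<in>I. mdist m (x i) (restrict z I i))"
      by (rule L2_set_le_sum) simp
    also have "\<dots> \<le> (\<Sum>i\<in>I. e')" using z by (intro sum_mono) (auto intro: less_imp_le)
    also have "\<dots> < e" using e by (simp add: e'_def field_simps)
    finally show ?thesis using z by (intro bexI[of _ "restrict z I"]) auto
  qed
qed fact

lemma measurable_descent_slope: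
  fixes f :: "'a \<Rightarrow> real"
  assumes lip: "\<And>x y. x \<in> mspace m \<Longrightarrow> y \<in> mspace m \<Longrightarrow> \<bar>f x - f y\<bar> \<le> L * mdist m x y" and "0 \<le> L"
  shows "descent_slope m f \<rho> \<in> borel_measurable \<mu>"
proof -
  note [measurable] = borel_measurable_lipschitz[OF assms]
  have [measurable]: "(\<lambda>x. mdist m y x) \<in> borel_measurable \<mu>" if "y \<in> dense_set" for y
    using that dense_set_subset by (intro measurable_mdist') auto
  note [simp] = countable_dense_set
  have "(\<lambda>x. SUP y\<in>dense_set. if 0 < mdist m y x \<and> mdist m y x < \<rho>
       then ennreal (max (f x - f y) 0 / mdist m y x) else 0) \<in> borel_measurable \<mu>"
    by measurable
  then show ?thesis
    by (subst measurable_cong[OF descent_slope_countable[OF _ dense_set_subset dense_set_dense lip]]) auto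
qed

lemma measurable_grad_minus_slice:
  fixes h :: "('i \<Rightarrow> 'a) \<Rightarrow> real"
  assumes i: "i \<in> I" and h: "h \<in> borel_measurable (PiM I (\<lambda>_. \<mu>))"
    and lip: "\<And>x y z. x \<in> PiE I (\<lambda>_. mspace m) \<Longrightarrow> y \<in> mspace m \<Longrightarrow> z \<in> mspace m \<Longrightarrow>
      \<bar>h (x(i := y)) - h (x(i := z))\<bar> \<le> L * mdist m y z"
  shows "(\<lambda>x. grad_minus m (\<lambda>z. h (x(i := z))) (x i)) \<in> borel_measurable (PiM I (\<lambda>_. \<mu>))"
proof -
  have [measurable]: "(\<lambda>x. mdist m y (x i)) \<in> borel_measurable (PiM I (\<lambda>_. \<mu>))" if "y \<in> dense_set" for y
    using measurable_compose[OF measurable_component_singleton[OF i, of "\<lambda>_. \<mu>"] measurable_mdist'[of y]]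
      that dense_set_subset by blast
  have [measurable]: "(\<lambda>x. h (x(i := y))) \<in> borel_measurable (PiM I (\<lambda>_. \<mu>))" if "y \<in> dense_set" for y
  proof -
    have "(\<lambda>x. x(i := y)) \<in> measurable (PiM I (\<lambda>_. \<mu>)) (PiM I (\<lambda>_. \<mu>))"
      using i that dense_set_subset
      by (intro measurable_fun_upd[where J = I] measurable_ident_sets[OF refl] measurable_const) auto
    then show ?thesis by (rule measurable_compose[OF _ h])
  qed
  note [measurable] = h
  note [simp] = countable_dense_set
  have "(\<lambda>x. INF k. SUP y\<in>dense_set. if 0 < mdist m y (x i) \<and> mdist m y (x i) < 1 / real (Suc k)
       then ennreal (max (h x - h (x(i := y))) 0 / mdist m y (x i)) else 0)
       \<in> borel_measurable (PiM I (\<lambda>_. \<mu>))"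
    by measurable
  moreover have "grad_minus m (\<lambda>z. h (x(i := z))) (x i) = (INF k. SUP y\<in>dense_set.
      if 0 < mdist m y (x i) \<and> mdist m y (x i) < 1 / real (Suc k)
      then ennreal (max (h x - h (x(i := y))) 0 / mdist m y (x i)) else 0)"
    if x: "x \<in> space (PiM I (\<lambda>_. \<mu>))" for x
  proof -
    have xi: "x i \<in> mspace m" using i x by auto
    have "descent_slope m (\<lambda>z. h (x(i := z))) \<rho> (x i) = (SUP y\<in>dense_set.
      if 0 < mdist m y (x i) \<and> mdist m y (x i) < \<rho>
      then ennreal (max (h (x(i := x i)) - h (x(i := y))) 0 / mdist m y (x i)) else 0)" for \<rho>
      using x by (intro descent_slope_countable[OF xi dense_set_subset dense_set_dense, where L = L] lip) auto
    then show ?thesis by (simp add: grad_minus_eq_INF_descent_slope[OF xi])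
  qed
  ultimately show ?thesis by (rule measurable_cong[THEN iffD2, rotated])
qed

end

section \<open>Sup-convolution on powers\<close>

context polish_prob begin

lemma pdist_commute: "pdist I x y = pdist I y x"
  by (simp add: mdist_commute)

lemma pdist_triangle:
  assumes "x \<in> PiE I (\<lambda>_. mspace m)" "y \<in> PiE I (\<lambda>_. mspace m)" "z \<in> PiE I (\<lambda>_. mspace m)"
  shows "pdist I x z \<le> pdist I x y + pdist I y z"
proof -
  have "pdist I x z \<le> L2_set (\<lambda>i. mdist m (x i) (y i) + mdist m (y i) (z i)) I"
    using assms by (intro L2_set_mono mdist_triangle) (auto simp: PiE_iff)
  also have "\<dots> \<le> pdist I x y + pdist I y z" by (rule L2_set_triangle_ineq)
  finally show ?thesis .
qed

lemma pdist_refl [simp]: "x \<in> PiE I (\<lambda>_. mspace m) \<Longrightarrow> pdist I x x = 0"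
  by (auto simp: L2_set_def PiE_iff intro!: sum.neutral)

lemma pdist_fun_upd:
  assumes "finite I" "i \<in> I" "x \<in> PiE I (\<lambda>_. mspace m)" "y \<in> mspace m" "z \<in> mspace m"
  shows "pdist I (x(i := y)) (x(i := z)) = mdist m y z"
proof -
  have "(\<Sum>j\<in>I. (mdist m ((x(i := y)) j) ((x(i := z)) j))\<^sup>2) = (mdist m y z)\<^sup>2 + (\<Sum>j\<in>I-{i}. 0)"
    using assms by (subst sum.remove[of _ i]) (auto intro!: sum.neutral simp: PiE_iff)
  then show ?thesis by (simp add: L2_set_def)
qed

lemma fun_upd_in_PiE: "x \<in> PiE I (\<lambda>_. S) \<Longrightarrow> i \<in> I \<Longrightarrow> y \<in> S \<Longrightarrow> x(i := y) \<in> PiE I (\<lambda>_. S)"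
  by (auto simp: PiE_iff extensional_def)

definition sup_conv :: "'i set \<Rightarrow> real \<Rightarrow> (('i \<Rightarrow> 'a) \<Rightarrow> real) \<Rightarrow> ('i \<Rightarrow> 'a) \<Rightarrow> real" where
  "sup_conv I \<delta> f x = (SUP y\<in>PiE I (\<lambda>_. mspace m). f y - sqrt (\<delta>\<^sup>2 + (pdist I x y)\<^sup>2))"

text \<open>
  The tangent line at \<open>u\<close> lies above the concave square root.
\<close>

lemma sqrt_add_le: "0 < u \<Longrightarrow> 0 \<le> w \<Longrightarrow> sqrt (u + w) \<le> sqrt u + w / (2 * sqrt u)" for u w :: real
proof (rule real_le_lsqrt)
  assume "0 < u" "0 \<le> w"
  then have "(sqrt u + w / (2 * sqrt u))\<^sup>2 = u + w + (w / (2 * sqrt u))\<^sup>2"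
    by (simp add: power2_sum)
  then show "u + w \<le> (sqrt u + w / (2 * sqrt u))\<^sup>2" by simp
qed auto

context
  fixes I :: "'i set" and f :: "('i \<Rightarrow> 'a) \<Rightarrow> real" and \<delta> :: real
  assumes I: "finite I" and \<delta>: "\<delta> > 0"
    and lip: "\<And>x y. x \<in> PiE I (\<lambda>_. mspace m) \<Longrightarrow> y \<in> PiE I (\<lambda>_. mspace m) \<Longrightarrow>
      \<bar>f x - f y\<bar> \<le> pdist I x y"
begin

lemma sup_conv_upper:
  assumes x: "x \<in> PiE I (\<lambda>_. mspace m)" and y: "y \<in> PiE I (\<lambda>_. mspace m)"
  shows "f y - sqrt (\<delta>\<^sup>2 + (pdist I x y)\<^sup>2) \<le> f x"
proof -
  have "pdist I x y \<le> sqrt (\<delta>\<^sup>2 + (pdist I x y)\<^sup>2)" by (rule real_le_rsqrt) simp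
  with lip[OF x y] show ?thesis by linarith
qed

lemma sup_conv_ge:
  assumes x: "x \<in> PiE I (\<lambda>_. mspace m)" and y: "y \<in> PiE I (\<lambda>_. mspace m)"
  shows "f y - sqrt (\<delta>\<^sup>2 + (pdist I x y)\<^sup>2) \<le> sup_conv I \<delta> f x"
  unfolding sup_conv_def using sup_conv_upper[OF x] y by (intro cSUP_upper bdd_aboveI2) auto

lemma sup_conv_le: "x \<in> PiE I (\<lambda>_. mspace m) \<Longrightarrow> sup_conv I \<delta> f x \<le> f x"
  unfolding sup_conv_def using sup_conv_upper by (intro cSUP_least) auto

lemma le_sup_conv: "x \<in> PiE I (\<lambda>_. mspace m) \<Longrightarrow> f x \<le> sup_conv I \<delta> f x + \<delta>"
  using sup_conv_ge[of x x] \<delta> by simp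

lemma sup_conv_lipschitz:
  assumes "x \<in> PiE I (\<lambda>_. mspace m)" "x' \<in> PiE I (\<lambda>_. mspace m)"
  shows "\<bar>sup_conv I \<delta> f x - sup_conv I \<delta> f x'\<bar> \<le> pdist I x x'"
proof -
  have *: "sup_conv I \<delta> f x \<le> sup_conv I \<delta> f x' + pdist I x x'"
    if x: "x \<in> PiE I (\<lambda>_. mspace m)" and x': "x' \<in> PiE I (\<lambda>_. mspace m)" for x x'
    unfolding sup_conv_def[of I \<delta> f x]
  proof (rule cSUP_least)
    show "PiE I (\<lambda>_. mspace m) \<noteq> {}" using x by auto
    fix y assume y: "y \<in> PiE I (\<lambda>_. mspace m)"
    have "\<bar>pdist I x' y - pdist I x y\<bar> \<le> pdist I x x'"
      using pdist_triangle[OF x x' y] pdist_triangle[OF x' x y] pdist_commute[of x' x I] by linarith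
    moreover have "sqrt (\<delta>\<^sup>2 + (pdist I x' y)\<^sup>2) \<le> sqrt (\<delta>\<^sup>2 + (pdist I x y)\<^sup>2) + \<bar>pdist I x' y - pdist I x y\<bar>"
      using real_sqrt_sum_squares_triangle_ineq[of \<delta> 0 "pdist I x y" "pdist I x' y - pdist I x y"] by simp
    ultimately show "f y - sqrt (\<delta>\<^sup>2 + (pdist I x y)\<^sup>2) \<le> sup_conv I \<delta> f x' + pdist I x x'"
      using sup_conv_ge[OF x' y] by linarith
  qed
  from *[OF assms] *[OF assms(2,1)] show ?thesis
    using pdist_commute[of x x' I] by linarith
qed

text \<open>
  The number \<open>v i\<close> is the partial derivative, in the distance from \<open>x i\<close> to \<open>y i\<close>, of the penalty
  \<open>sqrt (\<delta>\<^sup>2 + d\<^sub>2(x,y)\<^sup>2)\<close> for one point \<open>y\<close> that nearly attains the supremum at \<open>x\<close>. Moving \<open>x i\<close> by \<open>h\<close>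
  lowers the value of that \<open>y\<close> by at most \<open>h v i + h\<^sup>2 / (2 \<delta>)\<close>, so every partial slope is bounded by
  \<open>v i\<close> up to an error linear in the scale. As the gradient of a function \<open>sqrt (\<delta>\<^sup>2 + |a|\<^sup>2)\<close>, the vector \<open>v\<close>
  has norm at most 1.
\<close>

lemma sup_conv_common_direction:
  assumes x: "x \<in> PiE I (\<lambda>_. mspace m)" and \<rho>: "\<rho> > 0"
    and s: "\<And>i. i \<in> I \<Longrightarrow> ennreal (s i) \<le> descent_slope m (\<lambda>z. sup_conv I \<delta> f (x(i := z))) \<rho> (x i)"
  shows "\<exists>v. L2_set v I \<le> 1 \<and> (\<forall>i\<in>I. 0 \<le> v i \<and> s i \<le> v i + (1 / (2 * \<delta>) + 2) * \<rho>)"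
proof -
  let ?g = "sup_conv I \<delta> f"
  \<comment> \<open>Coordinates outside \<open>J\<close> satisfy the bound for any \<open>v\<close>.\<close>
  define J where "J = {i\<in>I. \<rho> < s i}"
  have "finite J" using I by (simp add: J_def)
  have "\<exists>z. z \<in> mspace m \<and> 0 < mdist m z (x i) \<and> mdist m z (x i) < \<rho> \<and>
      (s i - \<rho>) * mdist m z (x i) < ?g x - ?g (x(i := z))" if i: "i \<in> J" for i
  proof -
    have "ennreal (s i - \<rho>) < ennreal (s i)" using i \<rho> by (intro ennreal_lessI) (auto simp: J_def)
    also have "\<dots> \<le> descent_slope m (\<lambda>z. ?g (x(i := z))) \<rho> (x i)" using i by (intro s) (auto simp: J_def)
    finally obtain z where z: "z \<in> mspace m" "0 < mdist m z (x i)" "mdist m z (x i) < \<rho>"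
      "ennreal (s i - \<rho>) < ennreal (max (?g x - ?g (x(i := z))) 0 / mdist m z (x i))"
      unfolding descent_slope_def by (auto simp: less_SUP_iff)
    then have "s i - \<rho> < max (?g x - ?g (x(i := z))) 0 / mdist m z (x i)"
      using i by (auto simp: J_def ennreal_less_iff)
    then have "(s i - \<rho>) * mdist m z (x i) < max (?g x - ?g (x(i := z))) 0"
      using z by (simp add: pos_less_divide_eq)
    moreover have "0 \<le> (s i - \<rho>) * mdist m z (x i)" using i by (auto simp: J_def)
    ultimately show ?thesis using z by (intro exI[of _ z]) auto
  qed
  then obtain z where z: "\<And>i. i \<in> J \<Longrightarrow> z i \<in> mspace m \<and> 0 < mdist m (z i) (x i) \<and> mdist m (z i) (x i) < \<rho> \<and>
      (s i - \<rho>) * mdist m (z i) (x i) < ?g x - ?g (x(i := z i))"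
    by metis
  define h where "h i = mdist m (z i) (x i)" for i
  \<comment> \<open>The defect \<open>\<epsilon>\<close> of the near-maximiser is chosen after the finitely many step sizes \<open>h i\<close>, so that
      \<open>\<epsilon> / h i\<close> is small for all of them. One near-maximiser then serves all coordinates.\<close>
  define \<epsilon> where "\<epsilon> = Min (insert 1 ((\<lambda>i. \<rho> * h i) ` J))"
  have \<epsilon>: "\<epsilon> > 0" "\<And>i. i \<in> J \<Longrightarrow> \<epsilon> \<le> \<rho> * h i"
    using \<open>finite J\<close> z \<rho> by (auto simp: \<epsilon>_def h_def)
  have "?g x - \<epsilon> < ?g x" using \<epsilon> by simp
  then obtain y where y: "y \<in> PiE I (\<lambda>_. mspace m)" "?g x - \<epsilon> < f y - sqrt (\<delta>\<^sup>2 + (pdist I x y)\<^sup>2)"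
    unfolding sup_conv_def[of I \<delta> f x] using x sup_conv_upper[OF x]
    by (subst (asm) less_cSUP_iff) (auto intro!: bdd_aboveI2)
  define u where "u = \<delta>\<^sup>2 + (pdist I x y)\<^sup>2"
  have u: "u > 0" "\<delta> \<le> sqrt u" using \<delta> by (auto simp: u_def add_pos_nonneg intro!: real_le_rsqrt)
  define v where "v i = mdist m (x i) (y i) / sqrt u" for i
  have "L2_set v I = (1 / sqrt u) * pdist I x y"
    using u by (subst L2_set_right_distrib) (auto simp: v_def[abs_def])
  also have "\<dots> \<le> 1" using u by (auto simp: divide_le_eq u_def intro!: real_le_rsqrt)
  finally have "L2_set v I \<le> 1" .
  moreover have "0 \<le> v i \<and> s i \<le> v i + (1 / (2 * \<delta>) + 2) * \<rho>" if i: "i \<in> I" for i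
  proof
    show v0: "0 \<le> v i" using u by (simp add: v_def)
    show "s i \<le> v i + (1 / (2 * \<delta>) + 2) * \<rho>"
    proof (cases "i \<in> J")
      case False
      then have "s i \<le> \<rho>" using i by (simp add: J_def)
      also have "\<rho> \<le> (1 / (2 * \<delta>) + 2) * \<rho>" using \<rho> \<delta> by (simp add: field_simps)
      finally show ?thesis using v0 by simp
    next
      case True
      have hi: "0 < h i" "h i < \<rho>" using z[OF True] by (auto simp: h_def)
      define a where "a = mdist m (x i) (y i)"
      have a: "a \<ge> 0" by (simp add: a_def)
      have in': "x i \<in> mspace m" "y i \<in> mspace m" using x y i by auto
      have x': "x(i := z i) \<in> PiE I (\<lambda>_. mspace m)"
        using x i z[OF True] by (intro fun_upd_in_PiE) auto
      have "mdist m (z i) (y i) \<le> h i + a"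
        using mdist_triangle[of "z i" m "x i" "y i"] z[OF True] in' by (simp add: h_def a_def)
      then have le: "(mdist m (z i) (y i))\<^sup>2 \<le> (h i + a)\<^sup>2" by (intro power_mono) auto
      have "(pdist I (x(i := z i)) y)\<^sup>2 = (mdist m (z i) (y i))\<^sup>2 + (\<Sum>j\<in>I-{i}. (mdist m (x j) (y j))\<^sup>2)"
        using I i by (subst L2_set_def, subst real_sqrt_pow2) (auto simp: sum.remove[of I i] sum_nonneg)
      also have "\<dots> \<le> (h i + a)\<^sup>2 + ((pdist I x y)\<^sup>2 - a\<^sup>2)"
        using I i le by (simp add: L2_set_def sum_nonneg sum.remove[of I i] a_def)
      finally have "\<delta>\<^sup>2 + (pdist I (x(i := z i)) y)\<^sup>2 \<le> u + (2 * h i * a + (h i)\<^sup>2)"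
        by (simp add: u_def power2_sum)
      then have "sqrt (\<delta>\<^sup>2 + (pdist I (x(i := z i)) y)\<^sup>2) \<le> sqrt (u + (2 * h i * a + (h i)\<^sup>2))"
        by (rule real_sqrt_le_mono)
      also have "\<dots> \<le> sqrt u + (2 * h i * a + (h i)\<^sup>2) / (2 * sqrt u)"
        using u hi a by (intro sqrt_add_le) auto
      also have "(2 * h i * a + (h i)\<^sup>2) / (2 * sqrt u) = h i * v i + (h i)\<^sup>2 / (2 * sqrt u)"
        by (simp add: v_def a_def add_divide_distrib)
      also have "(h i)\<^sup>2 / (2 * sqrt u) \<le> (h i)\<^sup>2 / (2 * \<delta>)"
        using u \<delta> by (intro divide_left_mono) auto
      finally have 1: "sqrt (\<delta>\<^sup>2 + (pdist I (x(i := z i)) y)\<^sup>2) \<le> sqrt u + (h i * v i + (h i)\<^sup>2 / (2 * \<delta>))"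
        by simp
      have "(s i - \<rho>) * h i < ?g x - ?g (x(i := z i))" using z[OF True] by (simp add: h_def)
      also have "\<dots> \<le> ?g x - (f y - sqrt (\<delta>\<^sup>2 + (pdist I (x(i := z i)) y)\<^sup>2))"
        using sup_conv_ge[OF x' y(1)] by simp
      also have "\<dots> \<le> h i * v i + (h i)\<^sup>2 / (2 * \<delta>) + \<rho> * h i"
        using 1 y(2) \<epsilon>(2)[OF True] by (simp add: u_def)
      also have "\<dots> = (v i + h i / (2 * \<delta>) + \<rho>) * h i" by (simp add: algebra_simps power2_eq_square)
      finally have "s i - \<rho> < v i + h i / (2 * \<delta>) + \<rho>" using hi by simp
      also have "h i / (2 * \<delta>) \<le> \<rho> / (2 * \<delta>)" using hi \<delta> by (intro divide_right_mono) auto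
      finally show ?thesis using \<delta> by (simp add: algebra_simps)
    qed
  qed
  ultimately show ?thesis by blast
qed

text \<open>
  Let the scale in the previous lemma tend to 0.
\<close>

lemma sum_grad_minus_sup_conv_le_1:
  assumes x: "x \<in> PiE I (\<lambda>_. mspace m)"
  shows "(\<Sum>i\<in>I. (grad_minus m (\<lambda>z. sup_conv I \<delta> f (x(i := z))) (x i))\<^sup>2) \<le> 1"
proof -
  let ?G = "\<lambda>i. grad_minus m (\<lambda>z. sup_conv I \<delta> f (x(i := z))) (x i)"
  have G1: "?G i \<le> ennreal 1" if i: "i \<in> I" for i
  proof -
    have xi: "x i \<in> mspace m" using x i by auto
    have "?G i \<le> descent_slope m (\<lambda>z. sup_conv I \<delta> f (x(i := z))) 1 (x i)"
      by (rule grad_minus_le_descent_slope[OF xi]) simp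
    also have "\<dots> \<le> ennreal 1"
    proof (rule descent_slope_le)
      fix y assume y: "y \<in> mspace m"
      have "\<bar>sup_conv I \<delta> f (x(i := x i)) - sup_conv I \<delta> f (x(i := y))\<bar> \<le> pdist I (x(i := x i)) (x(i := y))"
        using x i y by (intro sup_conv_lipschitz fun_upd_in_PiE) auto
      also have "\<dots> = mdist m (x i) y" using x i y xi by (intro pdist_fun_upd I) auto
      finally show "sup_conv I \<delta> f (x(i := x i)) - sup_conv I \<delta> f (x(i := y)) \<le> 1 * mdist m y (x i)"
        by (simp add: mdist_commute)
    qed simp
    finally show ?thesis .
  qed
  define s where "s i = enn2real (?G i)" for i
  have s: "?G i = ennreal (s i)" if "i \<in> I" for i
    using le_less_trans[OF G1[OF that] ennreal_less_top] by (simp add: s_def)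
  have s0: "s i \<ge> 0" for i by (simp add: s_def)
  have "L2_set s I \<le> 1"
  proof (rule field_le_epsilon)
    fix e :: real assume e: "e > 0"
    define C where "C = 1 / (2 * \<delta>) + 2"
    define \<rho> where "\<rho> = e / (C * (real (card I) + 1))"
    have C: "C > 0" using \<delta> by (simp add: C_def add_pos_pos)
    have \<rho>: "\<rho> > 0" using e C by (simp add: \<rho>_def)
    have "\<exists>v. L2_set v I \<le> 1 \<and> (\<forall>i\<in>I. 0 \<le> v i \<and> s i \<le> v i + C * \<rho>)"
      unfolding C_def using x \<rho>
    proof (rule sup_conv_common_direction)
      fix i assume i: "i \<in> I"
      have xi: "x i \<in> mspace m" using x i by auto
      show "ennreal (s i) \<le> descent_slope m (\<lambda>z. sup_conv I \<delta> f (x(i := z))) \<rho> (x i)"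
        unfolding s[OF i, symmetric] by (rule grad_minus_le_descent_slope[OF xi \<rho>])
    qed
    then obtain v where v: "L2_set v I \<le> 1" "\<And>i. i \<in> I \<Longrightarrow> 0 \<le> v i \<and> s i \<le> v i + C * \<rho>" by blast
    have "L2_set s I \<le> L2_set (\<lambda>i. v i + C * \<rho>) I"
      using v(2) s0 by (intro L2_set_mono) auto
    also have "\<dots> \<le> L2_set v I + L2_set (\<lambda>i. C * \<rho>) I" by (rule L2_set_triangle_ineq)
    also have "L2_set (\<lambda>i. C * \<rho>) I \<le> (\<Sum>i\<in>I. C * \<rho>)" using C \<rho> by (intro L2_set_le_sum) simp
    also have "C * \<rho> = e / (real (card I) + 1)" using C by (simp add: \<rho>_def)
    also have "(\<Sum>i\<in>I. e / (real (card I) + 1)) \<le> e" using e by (simp add: field_simps)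
    finally show "L2_set s I \<le> 1 + e" using v(1) by simp
  qed
  then have "(\<Sum>i\<in>I. (s i)\<^sup>2) \<le> 1" by (simp add: L2_set_def)
  moreover have "(\<Sum>i\<in>I. (?G i)\<^sup>2) = ennreal (\<Sum>i\<in>I. (s i)\<^sup>2)"
  proof -
    have "(\<Sum>i\<in>I. (?G i)\<^sup>2) = (\<Sum>i\<in>I. ennreal ((s i)\<^sup>2))"
      using s s0 by (intro sum.cong refl) (simp only: ennreal_power)
    also have "\<dots> = ennreal (\<Sum>i\<in>I. (s i)\<^sup>2)" by (rule sum_ennreal) simp
    finally show ?thesis .
  qed
  ultimately show ?thesis by simp
qed

end

end

section \<open>Tensorization of the variance\<close>

text \<open>
  Polynomial in two integrals, which suits Fubini arguments for bounded functions better than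
  the centred form.
\<close>

definition real_variance :: "'b measure \<Rightarrow> ('b \<Rightarrow> real) \<Rightarrow> real" where
  "real_variance M h = (\<integral>x. (h x)\<^sup>2 \<partial>M) - (\<integral>x. h x \<partial>M)\<^sup>2"

lemma abs_power2_le: "\<bar>a\<bar> \<le> C \<Longrightarrow> \<bar>a\<^sup>2\<bar> \<le> C\<^sup>2" for a C :: real
  by (simp add: abs_le_square_iff[symmetric])

lemma (in prob_space) integrable_bounded:
  fixes h :: "'a \<Rightarrow> real"
  assumes "h \<in> borel_measurable M" "\<And>x. \<bar>h x\<bar> \<le> B"
  shows "integrable M h"
  using assms by (intro integrable_const_bound[where B = B]) auto

lemma (in prob_space) real_variance_eq:
  fixes h :: "'a \<Rightarrow> real"
  assumes "h \<in> borel_measurable M" "\<And>x. \<bar>h x\<bar> \<le> B"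
  shows "real_variance M h = (\<integral>x. (h x - (\<integral>y. h y \<partial>M))\<^sup>2 \<partial>M)"
proof -
  have "\<bar>(h x)\<^sup>2\<bar> \<le> B\<^sup>2" for x using assms(2)[of x] by (simp add: abs_le_square_iff[symmetric])
  then have "integrable M (\<lambda>x. (h x)\<^sup>2)"
    by (intro integrable_bounded) (use assms(1) in measurable)
  with integrable_bounded[OF assms] show ?thesis
    unfolding real_variance_def by (subst variance_eq) auto
qed

lemma abs_integral_bounded:
  assumes "prob_space M" "\<And>x. \<bar>h x\<bar> \<le> B"
  shows "\<bar>\<integral>x. h x \<partial>M\<bar> \<le> (B :: real)"
proof -
  interpret prob_space M by fact
  show ?thesis
  proof (cases "integrable M h")
    case True
    then have "\<bar>\<integral>x. h x \<partial>M\<bar> \<le> (\<integral>x. \<bar>h x\<bar> \<partial>M)" using integral_norm_bound[of M h] by simp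
    also have "\<dots> \<le> (\<integral>x. B \<partial>M)" using True assms(2) by (intro integral_mono) auto
    finally show ?thesis by (simp add: prob_space)
  next
    case False
    then show ?thesis using assms(2)[of undefined] by (simp add: not_integrable_integral_eq)
  qed
qed

lemma square_integral_le:
  fixes h :: "'a \<Rightarrow> real"
  assumes "prob_space M" "h \<in> borel_measurable M" "\<And>x. \<bar>h x\<bar> \<le> B"
  shows "(\<integral>x. h x \<partial>M)\<^sup>2 \<le> (\<integral>x. (h x)\<^sup>2 \<partial>M)"
proof -
  interpret prob_space M by fact
  have "0 \<le> real_variance M h"
    unfolding real_variance_eq[OF assms(2,3)] by simp
  then show ?thesis by (simp add: real_variance_def)
qed

text \<open>
  With \<open>H x\<close> the mean of \<open>F x\<close>, the total variance is the mean of the variances in \<open>y\<close> plus the variance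
  of \<open>H\<close>. As a mean over \<open>y\<close> of the functions \<open>F \<cdot> y\<close>, the function \<open>H\<close> has by Jensen's inequality a variance
  at most the mean of their variances.
\<close>

lemma real_variance_pair:
  fixes F :: "'a \<Rightarrow> 'b \<Rightarrow> real"
  assumes "prob_space P" "prob_space Q"
    and F [measurable]: "(\<lambda>(x, y). F x y) \<in> borel_measurable (P \<Otimes>\<^sub>M Q)"
    and B: "\<And>x y. \<bar>F x y\<bar> \<le> B"
  shows "(\<integral>x. \<integral>y. (F x y)\<^sup>2 \<partial>Q \<partial>P) - (\<integral>x. \<integral>y. F x y \<partial>Q \<partial>P)\<^sup>2
    \<le> (\<integral>x. real_variance Q (F x) \<partial>P) + (\<integral>y. real_variance P (\<lambda>x. F x y) \<partial>Q)"
proof -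
  interpret p1: prob_space P by fact
  interpret p2: prob_space Q by fact
  interpret PQ: pair_prob_space P Q ..
  define H where "H x = (\<integral>y. F x y \<partial>Q)" for x
  define K where "K y = (\<integral>x. F x y \<partial>P)" for y
  have F' [measurable]: "(\<lambda>(y, x). F x y) \<in> borel_measurable (Q \<Otimes>\<^sub>M P)"
    using measurable_pair_swap[OF F] by (simp add: case_prod_beta')
  have [measurable]: "F x \<in> borel_measurable Q" if "x \<in> space P" for x
    using that by measurable
  have [measurable]: "(\<lambda>x. F x y) \<in> borel_measurable P" if "y \<in> space Q" for y
    using that by measurable
  have Hm [measurable]: "H \<in> borel_measurable P" unfolding H_def by measurable
  have Km [measurable]: "K \<in> borel_measurable Q" unfolding K_def by measurable
  have HB: "\<bar>H x\<bar> \<le> B" for x unfolding H_def using B by (intro abs_integral_bounded p2.prob_space_axioms)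
  have KB: "\<bar>K y\<bar> \<le> B" for y unfolding K_def using B by (intro abs_integral_bounded p1.prob_space_axioms)
  have FKB: "\<bar>F x y - K y\<bar> \<le> 2 * B" for x y using B[of x y] KB[of y] by linarith
  have iK: "(\<integral>y. K y \<partial>Q) = (\<integral>x. H x \<partial>P)"
    unfolding H_def K_def by (rule PQ.Fubini_integral)
      (intro PQ.integrable_bounded, use B in \<open>auto split: prod.splits\<close>)
  have "real_variance P H = (\<integral>x. (H x - (\<integral>x. H x \<partial>P))\<^sup>2 \<partial>P)"
    by (rule p1.real_variance_eq[OF Hm HB])
  also have "\<dots> \<le> (\<integral>x. \<integral>y. (F x y - K y)\<^sup>2 \<partial>Q \<partial>P)"
  proof (rule integral_mono)
    show "integrable P (\<lambda>x. (H x - (\<integral>x. H x \<partial>P))\<^sup>2)"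
    proof (rule p1.integrable_bounded)
      show "\<bar>(H x - (\<integral>x. H x \<partial>P))\<^sup>2\<bar> \<le> (2 * B)\<^sup>2" for x
        using HB[of x] abs_integral_bounded[where h = H, OF p1.prob_space_axioms HB] by (intro abs_power2_le) linarith
    qed measurable
    show "integrable P (\<lambda>x. \<integral>y. (F x y - K y)\<^sup>2 \<partial>Q)"
    proof (rule p1.integrable_bounded)
      show "\<bar>\<integral>y. (F x y - K y)\<^sup>2 \<partial>Q\<bar> \<le> (2 * B)\<^sup>2" for x
        by (intro abs_integral_bounded p2.prob_space_axioms abs_power2_le FKB)
    qed measurable
    fix x assume x [measurable]: "x \<in> space P"
    have "(\<integral>y. F x y - K y \<partial>Q) = (\<integral>y. F x y \<partial>Q) - (\<integral>y. K y \<partial>Q)"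
      by (intro Bochner_Integration.integral_diff p2.integrable_bounded[where B = B] B KB) measurable
    then have "H x - (\<integral>x. H x \<partial>P) = (\<integral>y. F x y - K y \<partial>Q)"
      by (simp only: iK H_def[of x])
    also have "(\<integral>y. F x y - K y \<partial>Q)\<^sup>2 \<le> (\<integral>y. (F x y - K y)\<^sup>2 \<partial>Q)"
      by (intro square_integral_le[where B = "2 * B"] p2.prob_space_axioms FKB) measurable
    finally show "(H x - (\<integral>x. H x \<partial>P))\<^sup>2 \<le> (\<integral>y. (F x y - K y)\<^sup>2 \<partial>Q)" .
  qed
  also have "\<dots> = (\<integral>y. \<integral>x. (F x y - K y)\<^sup>2 \<partial>P \<partial>Q)"
  proof (rule PQ.Fubini_integral[symmetric], rule PQ.integrable_bounded)
    show "\<bar>case z of (x, y) \<Rightarrow> (F x y - K y)\<^sup>2\<bar> \<le> (2 * B)\<^sup>2" for z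
      using abs_power2_le[OF FKB] by (auto split: prod.splits)
  qed measurable
  also have "\<dots> = (\<integral>y. real_variance P (\<lambda>x. F x y) \<partial>Q)"
    by (intro Bochner_Integration.integral_cong refl)
      (simp add: p1.real_variance_eq[OF _ B] K_def)
  finally have 1: "real_variance P H \<le> (\<integral>y. real_variance P (\<lambda>x. F x y) \<partial>Q)" .
  have "(\<integral>x. real_variance Q (F x) \<partial>P) = (\<integral>x. \<integral>y. (F x y)\<^sup>2 \<partial>Q \<partial>P) - (\<integral>x. (H x)\<^sup>2 \<partial>P)"
    unfolding real_variance_def H_def[symmetric]
    by (intro Bochner_Integration.integral_diff p1.integrable_bounded[where B = "B\<^sup>2"] abs_integral_bounded
        p2.prob_space_axioms abs_power2_le HB B) measurable
  with 1 show ?thesis by (simp add: real_variance_def H_def)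
qed

context polish_prob begin

lemma prob_space_power: "prob_space (PiM I (\<lambda>_. \<mu>))"
  by (intro prob_space_PiM) unfold_locales

lemma ennreal_add_le: "ennreal (a + b) \<le> ennreal a + ennreal b"
proof -
  have "ennreal (a + b) \<le> ennreal (max a 0 + max b 0)" by (intro ennreal_leI) auto
  also have "\<dots> = ennreal (max a 0) + ennreal (max b 0)" by (rule ennreal_plus) auto
  also have "\<dots> = ennreal a + ennreal b" by (auto simp: max_def ennreal_neg)
  finally show ?thesis .
qed

lemma measurable_insert_update:
  assumes "i \<notin> I"
  shows "(\<lambda>(x, z). x(i := z)) \<in> measurable (PiM I (\<lambda>_. \<mu>) \<Otimes>\<^sub>M \<mu>) (PiM (insert i I) (\<lambda>_. \<mu>))"
  by (rule measurable_add_dim)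

text \<open>
  Induction on the index set with \<open>real_variance_pair\<close>. The functions \<open>D i\<close> stand for
  the squared partial slopes.
\<close>

lemma tensorization:
  fixes h :: "('i \<Rightarrow> 'a) \<Rightarrow> real" and D :: "'i \<Rightarrow> ('i \<Rightarrow> 'a) \<Rightarrow> ennreal"
  assumes "finite I" and "h \<in> borel_measurable (PiM I (\<lambda>_. \<mu>))" and "\<And>x. \<bar>h x\<bar> \<le> B"
    and "\<And>i. i \<in> I \<Longrightarrow> D i \<in> borel_measurable (PiM I (\<lambda>_. \<mu>))"
    and "\<And>i x. i \<in> I \<Longrightarrow> x \<in> PiE I (\<lambda>_. mspace m) \<Longrightarrow>
      ennreal (c * real_variance \<mu> (\<lambda>z. h (x(i := z)))) \<le> (\<integral>\<^sup>+z. D i (x(i := z)) \<partial>\<mu>)"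
    and c: "0 \<le> c"
  shows "ennreal (c * real_variance (PiM I (\<lambda>_. \<mu>)) h) \<le> (\<integral>\<^sup>+x. (\<Sum>i\<in>I. D i x) \<partial>PiM I (\<lambda>_. \<mu>))"
  using assms(1-5)
proof (induction I arbitrary: h D)
  case empty
  have "real_variance (PiM {} (\<lambda>_. \<mu>)) h
      = (\<integral>x. (h (\<lambda>_. undefined))\<^sup>2 \<partial>(PiM {} (\<lambda>_. \<mu>) :: ('i \<Rightarrow> 'a) measure)) -
        (\<integral>x. h (\<lambda>_. undefined) \<partial>(PiM {} (\<lambda>_. \<mu>) :: ('i \<Rightarrow> 'a) measure))\<^sup>2"
    unfolding real_variance_def
    by (intro arg_cong2[where f = minus] arg_cong[where f = "\<lambda>x. x\<^sup>2"] Bochner_Integration.integral_cong) auto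
  then show ?case using prob_space.prob_space[OF prob_space_power[of "{} :: 'i set"]] by simp
next
  case (insert i I)
  let ?P = "PiM I (\<lambda>_. \<mu>)" and ?P' = "PiM (insert i I) (\<lambda>_. \<mu>)"
  note hm [measurable] = insert.prems(1) and hB = insert.prems(2) and Dm = insert.prems(3)
  have Di [measurable]: "D i \<in> borel_measurable ?P'" using Dm by simp
  define F where "F x z = h (x(i := z))" for x z
  have upd [measurable]: "(\<lambda>(x, z). x(i := z)) \<in> measurable (?P \<Otimes>\<^sub>M \<mu>) ?P'"
    using insert.hyps by (intro measurable_insert_update)
  have Fm: "(\<lambda>(x, z). F x z) \<in> borel_measurable (?P \<Otimes>\<^sub>M \<mu>)"
    using measurable_compose[OF upd hm] by (simp add: F_def case_prod_beta')
  have upd_x: "(\<lambda>x. x(i := z)) \<in> measurable ?P ?P'" if "z \<in> mspace m" for z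
    using measurable_compose[OF measurable_Pair2' upd, of z] that by simp
  have FB: "\<bar>F x z\<bar> \<le> B" for x z by (simp add: F_def hB)
  have Fm': "(\<lambda>(z, x). F x z) \<in> borel_measurable (\<mu> \<Otimes>\<^sub>M ?P)"
    using measurable_pair_swap[OF Fm] by (simp add: case_prod_beta')
  have abs_diff_le: "\<bar>a\<bar> \<le> b \<Longrightarrow> \<bar>a'\<bar> \<le> b \<Longrightarrow> \<bar>a - a'\<bar> \<le> 2 * b" for a a' b :: real
    by linarith
  have int_h: "integrable ?P' h" "integrable ?P' (\<lambda>x. (h x)\<^sup>2)"
    using hB by (auto intro!: prob_space.integrable_bounded[OF prob_space_power] abs_power2_le)
  have "real_variance ?P' h = (\<integral>x. \<integral>z. (F x z)\<^sup>2 \<partial>\<mu> \<partial>?P) - (\<integral>x. \<integral>z. F x z \<partial>\<mu> \<partial>?P)\<^sup>2"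
    unfolding real_variance_def F_def using insert.hyps int_h
    by (simp add: power.product_integral_insert)
  also have "\<dots> \<le> (\<integral>x. real_variance \<mu> (F x) \<partial>?P) + (\<integral>z. real_variance ?P (\<lambda>x. F x z) \<partial>\<mu>)"
    by (rule real_variance_pair[OF prob_space_power prob_space_axioms Fm FB])
  finally have "ennreal (c * real_variance ?P' h) \<le>
      ennreal (c * (\<integral>x. real_variance \<mu> (F x) \<partial>?P) + c * (\<integral>z. real_variance ?P (\<lambda>x. F x z) \<partial>\<mu>))"
    using c by (intro ennreal_leI) (metis distrib_left mult_left_mono)
  also have "\<dots> \<le> ennreal (c * (\<integral>x. real_variance \<mu> (F x) \<partial>?P)) + ennreal (c * (\<integral>z. real_variance ?P (\<lambda>x. F x z) \<partial>\<mu>))"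
    by (rule ennreal_add_le)
  also have "ennreal (c * (\<integral>x. real_variance \<mu> (F x) \<partial>?P)) \<le> (\<integral>\<^sup>+x. D i x \<partial>?P')"
  proof -
    have "integrable ?P (\<lambda>x. real_variance \<mu> (F x))"
      unfolding real_variance_def
    proof (rule prob_space.integrable_bounded[OF prob_space_power])
      show "\<bar>(\<integral>z. (F x z)\<^sup>2 \<partial>\<mu>) - (\<integral>z. F x z \<partial>\<mu>)\<^sup>2\<bar> \<le> 2 * B\<^sup>2" for x
        by (intro abs_diff_le abs_power2_le abs_integral_bounded prob_space_axioms FB)
    qed (use Fm in measurable)
    moreover have "0 \<le> real_variance \<mu> (F x)" if "x \<in> space ?P" for x
    proof -
      have "F x \<in> borel_measurable \<mu>" using Fm that by measurable
      from square_integral_le[OF prob_space_axioms this FB] show ?thesis by (simp add: real_variance_def)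
    qed
    ultimately have "ennreal (c * (\<integral>x. real_variance \<mu> (F x) \<partial>?P)) = (\<integral>\<^sup>+x. ennreal (c * real_variance \<mu> (F x)) \<partial>?P)"
      using c by (subst nn_integral_eq_integral) (auto intro!: AE_I2)
    also have "\<dots> \<le> (\<integral>\<^sup>+x. \<integral>\<^sup>+z. D i (x(i := z)) \<partial>\<mu> \<partial>?P)"
    proof (rule nn_integral_mono)
      fix x assume x: "x \<in> space ?P"
      obtain w where w: "w \<in> mspace m" using not_empty by auto
      from x w have "x(i := w) \<in> PiE (insert i I) (\<lambda>_. mspace m)"
        by (auto simp: PiE_iff extensional_def)
      from insert.prems(4)[OF insertI1 this] show "ennreal (c * real_variance \<mu> (F x)) \<le> (\<integral>\<^sup>+z. D i (x(i := z)) \<partial>\<mu>)"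
        unfolding fun_upd_upd F_def[abs_def] .
    qed
    also have "\<dots> = (\<integral>\<^sup>+x. D i x \<partial>?P')"
      using insert.hyps by (intro power.product_nn_integral_insert[symmetric]) auto
    finally show ?thesis .
  qed
  also have "ennreal (c * (\<integral>z. real_variance ?P (\<lambda>x. F x z) \<partial>\<mu>)) \<le> (\<integral>\<^sup>+x. (\<Sum>j\<in>I. D j x) \<partial>?P')"
  proof -
    have "integrable \<mu> (\<lambda>z. real_variance ?P (\<lambda>x. F x z))"
      unfolding real_variance_def
    proof (rule integrable_bounded)
      show "\<bar>(\<integral>x. (F x z)\<^sup>2 \<partial>?P) - (\<integral>x. F x z \<partial>?P)\<^sup>2\<bar> \<le> 2 * B\<^sup>2" for z
        by (intro abs_diff_le abs_power2_le abs_integral_bounded prob_space_power FB)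
    qed (use Fm' in measurable)
    moreover have "0 \<le> real_variance ?P (\<lambda>x. F x z)" if "z \<in> space \<mu>" for z
    proof -
      have "(\<lambda>x. F x z) \<in> borel_measurable ?P" using Fm' that by measurable
      from square_integral_le[OF prob_space_power this FB] show ?thesis by (simp add: real_variance_def)
    qed
    ultimately have "ennreal (c * (\<integral>z. real_variance ?P (\<lambda>x. F x z) \<partial>\<mu>))
        = (\<integral>\<^sup>+z. ennreal (c * real_variance ?P (\<lambda>x. F x z)) \<partial>\<mu>)"
      using c by (subst nn_integral_eq_integral) (auto intro!: AE_I2)
    also have "\<dots> \<le> (\<integral>\<^sup>+z. \<integral>\<^sup>+x. (\<Sum>j\<in>I. D j (x(i := z))) \<partial>?P \<partial>\<mu>)"
    proof (rule nn_integral_mono)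
      fix z assume zs: "z \<in> space \<mu>"
      then have z: "z \<in> mspace m" by simp
      show "ennreal (c * real_variance ?P (\<lambda>x. F x z)) \<le> (\<integral>\<^sup>+x. (\<Sum>j\<in>I. D j (x(i := z))) \<partial>?P)"
      proof (rule insert.IH)
        show "(\<lambda>x. F x z) \<in> borel_measurable ?P"
          using measurable_compose[OF measurable_Pair1'[OF zs] Fm'] by simp
        show "(\<lambda>x. D j (x(i := z))) \<in> borel_measurable ?P" if "j \<in> I" for j
          by (rule measurable_compose[OF upd_x[OF z] Dm]) (simp add: that)
        fix j x assume j: "j \<in> I" and x: "x \<in> PiE I (\<lambda>_. mspace m)"
        have ji: "i \<noteq> j" using j insert.hyps by auto
        have "x(i := z) \<in> PiE (insert i I) (\<lambda>_. mspace m)"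
          using x z by (auto simp: PiE_iff extensional_def)
        from insert.prems(4)[OF insertI2[OF j] this]
        show "ennreal (c * real_variance \<mu> (\<lambda>w. F (x(j := w)) z)) \<le> (\<integral>\<^sup>+w. D j ((x(j := w))(i := z)) \<partial>\<mu>)"
          unfolding F_def fun_upd_twist[OF ji] .
      qed (rule FB)
    qed
    also have "\<dots> = (\<integral>\<^sup>+x. (\<Sum>j\<in>I. D j x) \<partial>?P')"
      using insert.hyps Dm by (intro power.product_nn_integral_insert_rev[symmetric]) auto
    finally show ?thesis .
  qed
  also have "(\<integral>\<^sup>+x. D i x \<partial>?P') + (\<integral>\<^sup>+x. (\<Sum>j\<in>I. D j x) \<partial>?P') = (\<integral>\<^sup>+x. (\<Sum>j\<in>insert i I. D j x) \<partial>?P')"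
    using insert.hyps Dm by (subst nn_integral_add[symmetric]) auto
  finally show ?case by (simp add: add_mono)
qed

end

section \<open>Exponential concentration from the Poincare inequality\<close>

context polish_prob begin

lemma poincare_bounded:
  fixes f :: "'a \<Rightarrow> real"
  assumes poi: "poincare m \<mu> (ennreal c)" and c: "0 \<le> c"
    and lip: "\<And>x y. x \<in> mspace m \<Longrightarrow> y \<in> mspace m \<Longrightarrow> \<bar>f x - f y\<bar> \<le> L * mdist m x y" and L: "0 \<le> L"
    and B: "\<And>x. \<bar>f x\<bar> \<le> B"
  shows "ennreal (c * real_variance \<mu> f) \<le> (\<integral>\<^sup>+x. (grad_minus m f x)\<^sup>2 \<partial>\<mu>)"
proof -
  have m: "f \<in> borel_measurable \<mu>" using lip L by (rule borel_measurable_lipschitz)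
  have "Lipschitz_continuous_map m euclidean_metric f"
    using lip by (auto simp: Lipschitz_continuous_map_def dist_real_def)
  with poi have "ennreal c * evariance \<mu> f \<le> (\<integral>\<^sup>+x. (grad_minus m f x)\<^sup>2 \<partial>\<mu>)"
    by (simp add: poincare_def)
  moreover have "evariance \<mu> f = ennreal (real_variance \<mu> f)"
  proof -
    have "integrable \<mu> (\<lambda>x. (f x - expectation f)\<^sup>2)"
    proof (rule integrable_bounded)
      show "\<bar>(f x - expectation f)\<^sup>2\<bar> \<le> (2 * B)\<^sup>2" for x
      proof -
        have "\<bar>f x - expectation f\<bar> \<le> 2 * B"
          using B[of x] abs_integral_bounded[where h = f, OF prob_space_axioms B] by linarith
        then show ?thesis by (rule abs_power2_le)
      qed
    qed (use m in measurable)
    then show ?thesis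
      using integrable_bounded[OF m B] real_variance_eq[OF m B]
      by (simp add: evariance_def nn_integral_eq_integral)
  qed
  ultimately show ?thesis using c by (simp add: ennreal_mult')
qed

lemma grad_minus_eq_0I:
  assumes "x \<in> mspace m" "\<rho> > 0" "\<And>y. y \<in> mspace m \<Longrightarrow> mdist m y x < \<rho> \<Longrightarrow> f x \<le> f y"
  shows "grad_minus m f x = 0"
proof -
  have "grad_minus m f x \<le> descent_slope m f \<rho> x"
    using assms by (intro grad_minus_le_descent_slope)
  also have "\<dots> \<le> ennreal 0"
    using assms(3) by (intro descent_slope_le) fastforce+
  finally show ?thesis by simp
qed

lemma grad_minus_mono:
  assumes x: "x \<in> mspace m" and le: "\<And>y. y \<in> mspace m \<Longrightarrow> max (f x - f y) 0 \<le> max (g x - g y) 0"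
  shows "grad_minus m f x \<le> grad_minus m g x"
  unfolding grad_minus_eq_INF_descent_slope[OF x] descent_slope_def
  by (intro INF_superset_mono order_refl SUP_subset_mono ennreal_leI divide_right_mono le) auto

text \<open>
  For \<open>h\<close> with mean \<open>e\<close>, value 0 on a set of measure \<open>q\<close> and value \<open>R\<close> on a set of measure \<open>p\<close>, the right-hand
  side is a lower bound for the variance.
\<close>

lemma variance_two_levels:
  fixes e R p q :: real
  assumes "0 \<le> p" "1 / 2 \<le> q" "p + q \<le> 1"
  shows "R\<^sup>2 * p / 2 \<le> q * e\<^sup>2 + p * (R - e)\<^sup>2"
proof -
  have "0 \<le> 2 * p * (e - R / 2)\<^sup>2" using assms by simp
  also have "\<dots> = 2 * p * e\<^sup>2 - 2 * p * R * e + p * R\<^sup>2 / 2"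
    by (simp add: power2_eq_square algebra_simps)
  also have "2 * p * e\<^sup>2 \<le> (q + p) * e\<^sup>2"
    using assms by (intro mult_right_mono) auto
  finally show ?thesis by (simp add: power2_eq_square algebra_simps)
qed

context
  fixes c R :: real and I :: "'i set" and P :: "('i \<Rightarrow> 'a) measure"
  assumes poi: "poincare m \<mu> (ennreal c)" and c: "0 < c" and I: "finite I"
  defines "P \<equiv> PiM I (\<lambda>_. \<mu>)" and "R \<equiv> sqrt (2 / c)"
begin

lemma R_pos: "R > 0" using c by (simp add: R_def)

lemma prob_space_P: "prob_space P" by (simp add: P_def prob_space_power)

lemma space_P: "space P = PiE I (\<lambda>_. mspace m)" by (simp add: P_def)

text \<open>
  The Poincare inequality for \<open>g - b\<close> cut off to \<open>[0, R]\<close>: its variance is at least \<open>R\<^sup>2 / 2 = 1 / c\<close> times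
  the mass above \<open>b + R\<close>, and the integral of its squared slopes is at most the mass of \<open>{b < g \<le> b + R}\<close>.
\<close>

lemma tail_halving:
  fixes g :: "('i \<Rightarrow> 'a) \<Rightarrow> real"
  assumes lip: "\<And>x y. x \<in> PiE I (\<lambda>_. mspace m) \<Longrightarrow> y \<in> PiE I (\<lambda>_. mspace m) \<Longrightarrow>
      \<bar>g x - g y\<bar> \<le> pdist I x y"
    and grad: "\<And>x. x \<in> PiE I (\<lambda>_. mspace m) \<Longrightarrow>
      (\<Sum>i\<in>I. (grad_minus m (\<lambda>z. g (x(i := z))) (x i))\<^sup>2) \<le> 1"
    and half: "measure P {x\<in>space P. g x \<le> b} \<ge> 1 / 2"
  shows "2 * measure P {x\<in>space P. b + R < g x} \<le> measure P {x\<in>space P. b < g x}"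
proof -
  interpret P: prob_space P by (rule prob_space_P)
  have gm [measurable]: "g \<in> borel_measurable P"
    unfolding P_def by (rule borel_measurable_lipschitz_power[OF I, where L = 1]) (use lip in auto)
  define h where "h x = min R (max 0 (g x - b))" for x
  have hm [measurable]: "h \<in> borel_measurable P" unfolding h_def by measurable
  have hB: "\<bar>h x\<bar> \<le> R" for x using R_pos by (auto simp: h_def)
  have slice: "\<bar>g (x(i := y)) - g (x(i := z))\<bar> \<le> mdist m y z"
    if "x \<in> PiE I (\<lambda>_. mspace m)" "i \<in> I" "y \<in> mspace m" "z \<in> mspace m" for x i y z
    using lip[OF fun_upd_in_PiE[OF that(1,2,3)] fun_upd_in_PiE[OF that(1,2,4)]] pdist_fun_upd[OF I that(2,1,3,4)]
    by simp
  have hlip: "\<bar>h (x(i := y)) - h (x(i := z))\<bar> \<le> 1 * mdist m y z"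
    if "x \<in> PiE I (\<lambda>_. mspace m)" "i \<in> I" "y \<in> mspace m" "z \<in> mspace m" for x i y z
    using slice[OF that] by (auto simp: h_def min_def max_def)
  define D where "D i x = (grad_minus m (\<lambda>z. h (x(i := z))) (x i))\<^sup>2" for i x
  let ?E = "{x\<in>space P. b < g x} - {x\<in>space P. b + R < g x}"
  have E: "?E \<in> sets P" by measurable
  have sumD: "(\<Sum>i\<in>I. D i x) \<le> indicator ?E x" if x: "x \<in> space P" for x
  proof -
    have x': "x \<in> PiE I (\<lambda>_. mspace m)" using x by (simp add: space_P)
    then have xi: "x i \<in> mspace m" if "i \<in> I" for i using that by auto
    consider "g x \<le> b" | "b + R < g x" | "b < g x" "g x \<le> b + R" by linarith
    then show ?thesis
    proof cases
      case 1
      have "D i x = 0" if i: "i \<in> I" for i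
      proof -
        have "grad_minus m (\<lambda>z. h (x(i := z))) (x i) = 0"
          using 1 R_pos by (intro grad_minus_eq_0I[OF xi[OF i], where \<rho> = 1]) (auto simp: h_def)
        then show ?thesis by (simp add: D_def)
      qed
      then show ?thesis by simp
    next
      case 2
      have "D i x = 0" if i: "i \<in> I" for i
      proof -
        have "grad_minus m (\<lambda>z. h (x(i := z))) (x i) = 0"
        proof (rule grad_minus_eq_0I[OF xi[OF i], where \<rho> = "g x - (b + R)"])
          fix y assume y: "y \<in> mspace m" "mdist m y (x i) < g x - (b + R)"
          have "\<bar>g (x(i := y)) - g x\<bar> \<le> mdist m y (x i)"
            using slice[OF x' i y(1) xi[OF i]] by simp
          with y have "g (x(i := y)) > b + R" by linarith
          then show "h (x(i := x i)) \<le> h (x(i := y))" using R_pos by (auto simp: h_def)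
        qed (use 2 in simp)
        then show ?thesis by (simp add: D_def)
      qed
      then show ?thesis by simp
    next
      case 3
      have "(\<Sum>i\<in>I. D i x) \<le> (\<Sum>i\<in>I. (grad_minus m (\<lambda>z. g (x(i := z))) (x i))\<^sup>2)"
        unfolding D_def
        by (intro sum_mono power_mono grad_minus_mono xi) (auto simp: h_def min_def max_def)
      also have "\<dots> \<le> 1" by (rule grad[OF x'])
      also have "1 = (indicator ?E x :: ennreal)" using 3 x by simp
      finally show ?thesis .
    qed
  qed
  define p where "p = measure P {x\<in>space P. b + R < g x}"
  define q where "q = measure P {x\<in>space P. g x \<le> b}"
  define e where "e = (\<integral>x. h x \<partial>P)"
  have pq: "0 \<le> p" "1 / 2 \<le> q" "p + q \<le> 1"
  proof -
    have "p + q = measure P ({x\<in>space P. b + R < g x} \<union> {x\<in>space P. g x \<le> b})"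
      unfolding p_def q_def using R_pos by (intro P.finite_measure_Union[symmetric]) auto
    then show "p + q \<le> 1" by simp
  qed (use half in \<open>auto simp: p_def q_def\<close>)
  have "p / c = R\<^sup>2 * p / 2" using c by (simp add: R_def)
  also have "\<dots> \<le> q * e\<^sup>2 + p * (R - e)\<^sup>2" using pq by (rule variance_two_levels)
  also have "\<dots> = (\<integral>x. indicator {x\<in>space P. g x \<le> b} x * e\<^sup>2 + indicator {x\<in>space P. b + R < g x} x * (R - e)\<^sup>2 \<partial>P)"
    unfolding p_def q_def
    by (subst Bochner_Integration.integral_add) (auto simp: P.emeasure_eq_measure less_top[symmetric])
  also have "\<dots> \<le> (\<integral>x. (h x - e)\<^sup>2 \<partial>P)"
  proof (rule integral_mono)
    show "integrable P (\<lambda>x. (h x - e)\<^sup>2)"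
    proof (rule P.integrable_bounded)
      show "\<bar>(h x - e)\<^sup>2\<bar> \<le> (2 * R)\<^sup>2" for x
      proof -
        have "\<bar>h x - e\<bar> \<le> 2 * R"
          using hB[of x] abs_integral_bounded[where h = h, OF prob_space_P hB] unfolding e_def by linarith
        then show ?thesis by (rule abs_power2_le)
      qed
    qed measurable
    show "indicator {x\<in>space P. g x \<le> b} x * e\<^sup>2 + indicator {x\<in>space P. b + R < g x} x * (R - e)\<^sup>2 \<le> (h x - e)\<^sup>2"
      if "x \<in> space P" for x
      using that R_pos by (auto simp: h_def indicator_def)
  qed (auto simp: P.emeasure_eq_measure less_top[symmetric])
  also have "\<dots> = real_variance P h" unfolding e_def by (rule P.real_variance_eq[OF hm hB, symmetric])
  finally have var: "p \<le> c * real_variance P h" using c by (simp add: field_simps)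
  have "ennreal (c * real_variance P h) \<le> (\<integral>\<^sup>+x. (\<Sum>i\<in>I. D i x) \<partial>P)"
    unfolding P_def
  proof (rule tensorization[OF I])
    show "h \<in> borel_measurable (PiM I (\<lambda>_. \<mu>))" using hm by (simp add: P_def)
    show "D i \<in> borel_measurable (PiM I (\<lambda>_. \<mu>))" if "i \<in> I" for i
    proof -
      have [measurable]: "(\<lambda>x. grad_minus m (\<lambda>z. h (x(i := z))) (x i)) \<in> borel_measurable (PiM I (\<lambda>_. \<mu>))"
        by (rule measurable_grad_minus_slice[OF that hm[unfolded P_def] hlip[OF _ that]])
      show ?thesis unfolding D_def by measurable
    qed
    fix i x assume i: "i \<in> I" and x: "x \<in> PiE I (\<lambda>_. mspace m)"
    have "ennreal (c * real_variance \<mu> (\<lambda>z. h (x(i := z)))) \<le> (\<integral>\<^sup>+z. (grad_minus m (\<lambda>z. h (x(i := z))) z)\<^sup>2 \<partial>\<mu>)"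
      using poi c hlip[OF x i] hB by (intro poincare_bounded[where L = 1 and B = R]) auto
    then show "ennreal (c * real_variance \<mu> (\<lambda>z. h (x(i := z)))) \<le> (\<integral>\<^sup>+z. D i (x(i := z)) \<partial>\<mu>)"
      by (simp add: D_def)
  qed (use hB c in auto)
  also have "\<dots> \<le> (\<integral>\<^sup>+x. indicator ?E x \<partial>P)" by (intro nn_integral_mono sumD)
  also have "\<dots> = ennreal (measure P ?E)" using E by (simp add: P.emeasure_eq_measure)
  finally have "c * real_variance P h \<le> measure P ?E" by (simp add: ennreal_le_iff)
  also have "\<dots> = measure P {x\<in>space P. b < g x} - p"
    unfolding p_def using R_pos by (intro P.finite_measure_Diff) auto
  finally show ?thesis using var by (simp add: p_def)
qed

text \<open>
  The previous lemma applies to the sup-convolution with parameter \<open>R\<close>. It lies within \<open>R\<close> below \<open>f\<close>,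
  which costs one of the \<open>Suc k\<close> steps.
\<close>

lemma upper_tail:
  fixes f :: "('i \<Rightarrow> 'a) \<Rightarrow> real"
  assumes lip: "\<And>x y. x \<in> PiE I (\<lambda>_. mspace m) \<Longrightarrow> y \<in> PiE I (\<lambda>_. mspace m) \<Longrightarrow>
      \<bar>f x - f y\<bar> \<le> pdist I x y"
    and half: "measure P {x\<in>space P. f x \<le> b} \<ge> 1 / 2"
  shows "measure P {x\<in>space P. b + real (Suc k) * R < f x} \<le> (1 / 2) ^ Suc k"
proof -
  interpret P: prob_space P by (rule prob_space_P)
  define g where "g = sup_conv I R f"
  have glip: "\<bar>g x - g y\<bar> \<le> pdist I x y"
    if "x \<in> PiE I (\<lambda>_. mspace m)" "y \<in> PiE I (\<lambda>_. mspace m)" for x y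
    unfolding g_def using I R_pos lip that by (rule sup_conv_lipschitz)
  have grad: "(\<Sum>i\<in>I. (grad_minus m (\<lambda>z. g (x(i := z))) (x i))\<^sup>2) \<le> 1" if "x \<in> PiE I (\<lambda>_. mspace m)" for x
    unfolding g_def using I R_pos lip that by (rule sum_grad_minus_sup_conv_le_1)
  have [measurable]: "g \<in> borel_measurable P" "f \<in> borel_measurable P"
    unfolding P_def by (rule borel_measurable_lipschitz_power[OF I, where L = 1]; use glip lip in simp)+
  have gf: "g x \<le> f x" "f x \<le> g x + R" if "x \<in> space P" for x
    using that sup_conv_le[of I R f x] le_sup_conv[of I R f x] I R_pos lip by (auto simp: g_def space_P)
  have tail: "measure P {x\<in>space P. b + real k * R < g x} \<le> (1 / 2) ^ Suc k" for k
  proof (induction k)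
    case 0
    have "1 / 2 \<le> measure P {x\<in>space P. g x \<le> b}"
      using half by (rule order_trans) (intro P.finite_measure_mono, use gf in fastforce, measurable)
    also have "\<dots> = 1 - measure P {x\<in>space P. b < g x}"
      by (subst P.prob_neg[symmetric]) (auto simp: not_less)
    finally show ?case by simp
  next
    case (Suc k)
    have "1 / 2 \<le> measure P {x\<in>space P. f x \<le> b}" by (rule half)
    also have "\<dots> \<le> measure P {x\<in>space P. g x \<le> b + real k * R}"
    proof (rule P.finite_measure_mono)
      have "0 \<le> real k * R" using R_pos by simp
      then show "{x\<in>space P. f x \<le> b} \<subseteq> {x\<in>space P. g x \<le> b + real k * R}"
        using gf(1) by fastforce
    qed measurable
    finally have "2 * measure P {x\<in>space P. (b + real k * R) + R < g x} \<le> measure P {x\<in>space P. b + real k * R < g x}"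
      using glip grad by (intro tail_halving)
    with Suc show ?case by (simp add: algebra_simps)
  qed
  have "measure P {x\<in>space P. b + real (Suc k) * R < f x} \<le> measure P {x\<in>space P. b + real k * R < g x}"
  proof (rule P.finite_measure_mono)
    show "{x\<in>space P. b + real (Suc k) * R < f x} \<subseteq> {x\<in>space P. b + real k * R < g x}"
      using gf(2) by (fastforce simp: algebra_simps)
  qed measurable
  with tail[of k] show ?thesis by linarith
qed

end

end

text \<open>
  The infimum of all \<open>x\<close> with \<open>cdf x \<ge> 1/2\<close> is a median, by right continuity and by the
  left limits of the distribution function.
\<close>

lemma (in real_distribution) median_exists:
  "\<exists>b. measure M {..b} \<ge> 1 / 2 \<and> measure M {b..} \<ge> 1 / 2"
proof -
  define S where "S = {x. 1 / 2 \<le> cdf M x}"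
  define b where "b = Inf S"
  have "eventually (\<lambda>x. 1 / 2 < cdf M x) at_top"
    by (rule order_tendstoD(1)[OF cdf_lim_at_top_prob]) simp
  then obtain u where "u \<in> S" by (auto simp: S_def eventually_at_top_linorder intro: less_imp_le)
  have "eventually (\<lambda>x. cdf M x < 1 / 2) at_bot"
    by (rule order_tendstoD(2)[OF cdf_lim_at_bot]) simp
  then obtain l where l: "\<And>x. x \<le> l \<Longrightarrow> cdf M x < 1 / 2" by (auto simp: eventually_at_bot_linorder)
  have bdd: "bdd_below S"
  proof (rule bdd_belowI)
    show "l \<le> x" if "x \<in> S" for x using that l[of x] by (force simp: S_def not_le[symmetric])
  qed
  have up: "1 / 2 \<le> cdf M x" if "b < x" for x
  proof -
    have "S \<noteq> {}" using \<open>u \<in> S\<close> by auto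
    moreover have "Inf S < x" using that by (simp add: b_def)
    ultimately obtain y where "y \<in> S" "y < x"
      using cInf_less_iff[of S x] bdd by blast
    then show ?thesis using cdf_nondecreasing[of y x] by (simp add: S_def)
  qed
  have dn: "cdf M x \<le> 1 / 2" if "x < b" for x
    using that cInf_lower[OF _ bdd, of x] by (force simp: S_def b_def)
  have "1 / 2 \<le> cdf M b"
    using cdf_is_right_cont[of b] unfolding continuous_within
    by (rule tendsto_lowerbound) (use up in \<open>auto intro!: eventually_at_rightI[of b "b + 1"]\<close>)
  moreover have "measure M {..<b} \<le> 1 / 2"
    by (rule tendsto_upperbound[OF cdf_at_left])
      (use dn in \<open>auto intro!: eventually_at_leftI[of "b - 1" b]\<close>)
  moreover have "measure M {b..} = 1 - measure M {..<b}"
    using prob_compl[of "{..<b}"] by (simp add: Compl_eq_Diff_UNIV[symmetric])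
  ultimately show ?thesis by (auto simp: cdf_def)
qed

context polish_prob begin

context
  fixes c R :: real and I :: "'i set" and P :: "('i \<Rightarrow> 'a) measure"
  assumes poi: "poincare m \<mu> (ennreal c)" and c: "0 < c" and I: "finite I"
  defines "P \<equiv> PiM I (\<lambda>_. \<mu>)" and "R \<equiv> sqrt (2 / c)"
begin

text \<open>
  The upper tail estimate for \<open>f\<close> and \<open>- f\<close>, both at the same median \<open>b\<close>.
\<close>

lemma two_sided_concentration:
  fixes f :: "('i \<Rightarrow> 'a) \<Rightarrow> real"
  assumes lip: "\<And>x y. x \<in> PiE I (\<lambda>_. mspace m) \<Longrightarrow> y \<in> PiE I (\<lambda>_. mspace m) \<Longrightarrow>
      \<bar>f x - f y\<bar> \<le> pdist I x y"
  shows "\<exists>b. measure (distr P borel f) {b - real (Suc k) * R .. b + real (Suc k) * R} \<ge> 1 - (1 / 2) ^ k"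
proof -
  interpret P: prob_space P unfolding P_def by (rule prob_space_power)
  have fm [measurable]: "f \<in> borel_measurable P"
    unfolding P_def by (rule borel_measurable_lipschitz_power[OF I, where L = 1]) (use lip in simp_all)
  interpret D: real_distribution "distr P borel f" by (rule P.real_distribution_distr) measurable
  obtain b where b: "measure (distr P borel f) {..b} \<ge> 1 / 2" "measure (distr P borel f) {b..} \<ge> 1 / 2"
    using D.median_exists by blast
  have set_eq: "f -` {..b} \<inter> space P = {x\<in>space P. f x \<le> b}"
    "f -` {b..} \<inter> space P = {x\<in>space P. - f x \<le> - b}" by auto
  define E where "E = {b - real (Suc k) * R .. b + real (Suc k) * R}"
  define U where "U = {x\<in>space P. b + real (Suc k) * R < f x}"
  define L where "L = {x\<in>space P. - b + real (Suc k) * R < - f x}"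
  have [measurable]: "U \<in> sets P" "L \<in> sets P" unfolding U_def L_def by measurable
  have "measure P U \<le> (1 / 2) ^ Suc k"
    unfolding P_def R_def U_def
    by (rule upper_tail[OF poi c I lip]) (use b(1) in \<open>simp_all add: measure_distr set_eq P_def[symmetric]\<close>)
  moreover have "measure P L \<le> (1 / 2) ^ Suc k"
    unfolding P_def R_def L_def
  proof (rule upper_tail[OF poi c I])
    show "\<bar>- f x - - f y\<bar> \<le> pdist I x y"
      if "x \<in> PiE I (\<lambda>_. mspace m)" "y \<in> PiE I (\<lambda>_. mspace m)" for x y
      using lip[OF that] by simp
  qed (use b(2) in \<open>simp add: measure_distr set_eq P_def[symmetric]\<close>)
  moreover have "f -` E \<inter> space P = space P - (U \<union> L)"
    by (auto simp: E_def U_def L_def)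
  then have "measure (distr P borel f) E = 1 - measure P (U \<union> L)"
    by (simp add: E_def measure_distr P.prob_compl)
  moreover have "measure P (U \<union> L) \<le> measure P U + measure P L" by (rule measure_Un_le) auto
  ultimately have "measure (distr P borel f) E \<ge> 1 - (1 / 2) ^ k" by simp
  then show ?thesis unfolding E_def by blast
qed

lemma part_diam_le:
  fixes f :: "('i \<Rightarrow> 'a) \<Rightarrow> real"
  assumes lip: "\<And>x y. x \<in> PiE I (\<lambda>_. mspace m) \<Longrightarrow> y \<in> PiE I (\<lambda>_. mspace m) \<Longrightarrow>
      \<bar>f x - f y\<bar> \<le> pdist I x y"
    and t: "(1 / 2) ^ k \<le> t"
  shows "part_diam euclidean_metric (distr P borel f) t \<le> ennreal (2 * real (Suc k) * R)"
proof -
  obtain b where b: "measure (distr P borel f) {b - real (Suc k) * R .. b + real (Suc k) * R} \<ge> 1 - (1 / 2) ^ k"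
    using two_sided_concentration[OF lip] by blast
  let ?E = "{b - real (Suc k) * R .. b + real (Suc k) * R}"
  have "part_diam euclidean_metric (distr P borel f) t \<le> ediam euclidean_metric ?E"
    unfolding part_diam_def using b t by (intro INF_lower) auto
  also have "\<dots> \<le> ennreal (2 * real (Suc k) * R)"
    unfolding ediam_def by (intro SUP_least ennreal_leI) (auto simp: dist_real_def abs_le_iff algebra_simps)
  finally show ?thesis .
qed

end

lemma r_infty_le:
  assumes poi: "poincare m \<mu> (ennreal c)" and c: "0 < c" and t: "0 < t" "t < 1 / 2"
  shows "r_infty m \<mu> t * ennreal (sqrt c) \<le> ennreal (2 * sqrt 2 / ln 2 * ln (4 / t))"
proof -
  \<comment> \<open>The least \<open>k\<close> with \<open>(1 / 2) ^ k \<le> t\<close>.\<close>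
  define k where "k = nat \<lceil>log 2 (1 / t)\<rceil>"
  have log0: "0 \<le> log 2 (1 / t)" using t by simp
  have "log 2 (1 / t) \<le> real k" by (simp add: k_def real_nat_ceiling_ge)
  then have "1 / t \<le> 2 powr real k" using t by (simp add: log_le_iff)
  then have kt: "(1 / 2) ^ k \<le> t" using t by (simp add: powr_realpow field_simps)
  have "real k \<le> log 2 (1 / t) + 1" using log0 by (simp add: k_def)
  then have "real (Suc k) \<le> log 2 (1 / t) + log 2 4" using log_pow_cancel[of 2 2] by simp
  also have "\<dots> = log 2 (4 / t)" using t by (simp add: log_divide)
  finally have k: "real (Suc k) \<le> log 2 (4 / t)" .
  have "r_infty m \<mu> t \<le> ennreal (2 * real (Suc k) * sqrt (2 / c))"
    unfolding r_infty_def obs_diam_def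
  proof (intro SUP_least)
    fix n f
    assume "f \<in> {f. \<forall>x\<in>mspace (power_metric n m). \<forall>y\<in>mspace (power_metric n m). \<bar>f x - f y\<bar> \<le> mdist (power_metric n m) x y}"
    then show "part_diam euclidean_metric (distr (PiM {1..n} (\<lambda>_. \<mu>)) borel f) t \<le> ennreal (2 * real (Suc k) * sqrt (2 / c))"
      using poi c kt by (intro part_diam_le) (auto simp: L2_set_def)
  qed
  then have "r_infty m \<mu> t * ennreal (sqrt c) \<le> ennreal (2 * real (Suc k) * sqrt (2 / c)) * ennreal (sqrt c)"
    by (rule mult_right_mono) simp
  also have "\<dots> = ennreal (2 * real (Suc k) * sqrt 2)"
    using c by (subst ennreal_mult[symmetric]) (auto simp: real_sqrt_divide)
  also have "\<dots> \<le> ennreal (2 * sqrt 2 / ln 2 * ln (4 / t))"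
  proof (rule ennreal_leI)
    have "2 * real (Suc k) * sqrt 2 = 2 * sqrt 2 * real (Suc k)" by simp
    also have "\<dots> \<le> 2 * sqrt 2 * log 2 (4 / t)" using k by (intro mult_left_mono) auto
    finally show "2 * real (Suc k) * sqrt 2 \<le> 2 * sqrt 2 / ln 2 * ln (4 / t)" by (simp add: log_def)
  qed
  finally show ?thesis .
qed

end

section \<open>The Gaussian tail\<close>

lemma Phi_bar_eq_measure: "Phi_bar x = measure std_normal_distribution {x..}"
proof -
  interpret real_distribution std_normal_distribution by (rule real_dist_normal_dist)
  have "measure std_normal_distribution {x..} = (\<integral>u. indicator {x..} u \<partial>std_normal_distribution)"
    by simp
  also have "\<dots> = (\<integral>u. std_normal_density u * indicator {x..} u \<partial>lborel)"
    by (rule integral_real_density) auto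
  also have "\<dots> = (\<integral>u. 1 / sqrt (2 * pi) * (indicator {x..} u * exp (- (u\<^sup>2) / 2)) \<partial>lborel)"
    by (intro Bochner_Integration.integral_cong refl) (simp add: std_normal_density_def)
  also have "\<dots> = Phi_bar x"
    unfolding Phi_bar_def set_lebesgue_integral_def by (subst integral_mult_right_zero) simp
  finally show ?thesis ..
qed

lemma measure_std_normal_ivl_pos:
  assumes "x < y" shows "0 < measure std_normal_distribution {x..<y}"
proof -
  interpret real_distribution std_normal_distribution by (rule real_dist_normal_dist)
  have "emeasure std_normal_distribution {x..<y} \<noteq> 0"
  proof
    assume "emeasure std_normal_distribution {x..<y} = 0"
    then have "(\<integral>\<^sup>+u. ennreal (std_normal_density u) * indicator {x..<y} u \<partial>lborel) = 0"
      by (simp add: emeasure_density)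
    then have "AE u in lborel. ennreal (std_normal_density u) * indicator {x..<y} u = 0"
      by (subst (asm) nn_integral_0_iff_AE) auto
    then have "AE u in lborel. u \<notin> {x..<y}"
    proof eventually_elim
      case (elim u)
      have "0 < std_normal_density u" by (simp add: normal_density_pos)
      with elim show ?case by (auto simp: indicator_def ennreal_eq_0_iff split: if_splits)
    qed
    then have "emeasure lborel {x..<y} = 0"
      by (subst (asm) AE_iff_measurable[OF _ refl]) (simp_all add: atLeastLessThan_def atLeast_def lessThan_def Int_def)
    with assms show False by simp
  qed
  then show ?thesis by (simp add: emeasure_eq_measure zero_less_measure_iff)
qed

lemma Phi_bar_strict_antimono: "x < y \<Longrightarrow> Phi_bar y < Phi_bar x"
proof -
  assume xy: "x < y"
  interpret real_distribution std_normal_distribution by (rule real_dist_normal_dist)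
  have "{x..} = {x..<y} \<union> {y..}" using xy by auto
  then have "Phi_bar x = measure std_normal_distribution {x..<y} + Phi_bar y"
    unfolding Phi_bar_eq_measure by (simp only:, intro finite_measure_Union) auto
  with measure_std_normal_ivl_pos[OF xy] show ?thesis by simp
qed

lemma std_normal_null_singleton: "measure std_normal_distribution {x} = 0"
proof -
  have "emeasure std_normal_distribution {x} = 0"
    by (simp add: emeasure_density nn_integral_0_iff_AE)
  then show ?thesis by (simp add: measure_def)
qed

lemma isCont_cdf_std_normal: "isCont (cdf std_normal_distribution) x"
proof -
  interpret real_distribution std_normal_distribution by (rule real_dist_normal_dist)
  show ?thesis by (simp add: isCont_cdf std_normal_null_singleton)
qed

lemma cdf_std_normal: "cdf std_normal_distribution x = 1 - Phi_bar x"
proof -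
  interpret real_distribution std_normal_distribution by (rule real_dist_normal_dist)
  have "1 = measure std_normal_distribution ({..x} \<union> {x<..})"
  proof -
    have "{..x} \<union> {x<..} = UNIV" by auto
    with prob_space show ?thesis by simp
  qed
  also have "\<dots> = cdf std_normal_distribution x + measure std_normal_distribution {x<..}"
    unfolding cdf_def by (intro finite_measure_Union) auto
  also have "measure std_normal_distribution {x<..} = Phi_bar x"
  proof -
    have "{x..} = {x} \<union> {x<..}" by auto
    then have "Phi_bar x = measure std_normal_distribution {x} + measure std_normal_distribution {x<..}"
      unfolding Phi_bar_eq_measure by (simp only:, intro finite_measure_Union) auto
    then show ?thesis by (simp add: std_normal_null_singleton)
  qed
  finally show ?thesis by simp
qed

lemma Phi_bar_0: "Phi_bar 0 = 1 / 2"
proof -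
  interpret real_distribution std_normal_distribution by (rule real_dist_normal_dist)
  have "measure std_normal_distribution {..0} = (\<integral>u. indicator {..0} u \<partial>std_normal_distribution)"
    by simp
  also have "\<dots> = (\<integral>u. std_normal_density u * indicator {..0} u \<partial>lborel)"
    by (rule integral_real_density) auto
  also have "\<dots> = (\<integral>u. std_normal_density (-u) * indicator {..0} (-u) \<partial>lborel)"
    by (subst lborel_integral_real_affine[where c = "-1" and t = 0]) auto
  also have "\<dots> = (\<integral>u. std_normal_density u * indicator {0..} u \<partial>lborel)"
    by (intro Bochner_Integration.integral_cong) (auto simp: std_normal_density_def indicator_def)
  also have "\<dots> = (\<integral>u. indicator {0..} u \<partial>std_normal_distribution)"
    by (rule integral_real_density[symmetric]) auto
  also have "\<dots> = Phi_bar 0" by (simp add: Phi_bar_eq_measure)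
  finally have "cdf std_normal_distribution 0 = Phi_bar 0" by (simp add: cdf_def)
  then show ?thesis by (simp add: cdf_std_normal)
qed

lemma Phi_bar_inv:
  assumes t: "0 < t" "t < 1" shows "Phi_bar (inv Phi_bar t) = t"
proof -
  interpret real_distribution std_normal_distribution by (rule real_dist_normal_dist)
  have "eventually (\<lambda>x. 1 - t < cdf std_normal_distribution x) at_top"
    by (rule order_tendstoD(1)[OF cdf_lim_at_top_prob]) (use t in simp)
  then obtain u where u: "\<And>x. u \<le> x \<Longrightarrow> 1 - t < cdf std_normal_distribution x" by (auto simp: eventually_at_top_linorder)
  have "eventually (\<lambda>x. cdf std_normal_distribution x < 1 - t) at_bot"
    by (rule order_tendstoD(2)[OF cdf_lim_at_bot]) (use t in simp)
  then obtain l where l: "\<And>x. x \<le> l \<Longrightarrow> cdf std_normal_distribution x < 1 - t" by (auto simp: eventually_at_bot_linorder)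
  have "\<exists>x\<ge>min l u. x \<le> max l u \<and> cdf std_normal_distribution x = 1 - t"
    by (rule IVT) (use u[of "max l u"] l[of "min l u"] isCont_cdf_std_normal in \<open>auto intro: less_imp_le\<close>)
  then obtain x where "Phi_bar x = t" by (auto simp: cdf_std_normal)
  then show ?thesis by (intro f_inv_into_f) auto
qed

lemma inv_Phi_bar_le:
  assumes t: "0 < t" "t < 1" and "Phi_bar x \<le> t" shows "inv Phi_bar t \<le> x"
  using Phi_bar_strict_antimono[of x "inv Phi_bar t"] Phi_bar_inv[OF t] assms by linarith

lemma inv_Phi_bar_pos:
  assumes t: "0 < t" "t < 1 / 2" shows "0 < inv Phi_bar t"
proof (rule ccontr)
  assume "\<not> 0 < inv Phi_bar t"
  then have "Phi_bar 0 \<le> Phi_bar (inv Phi_bar t)"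
    using Phi_bar_strict_antimono[of "inv Phi_bar t" 0] by (cases "inv Phi_bar t = 0") auto
  with t show False by (simp add: Phi_bar_0 Phi_bar_inv)
qed

section \<open>The Poincare inequality from concentration\<close>

text \<open>
  Apply the hypothesis to the distance from \<open>A\<close>. It takes values in a set \<open>B\<close> of diameter below \<open>r\<close> with
  probability at least \<open>1 - t > 1/2\<close>, and vanishes with probability at least \<open>1/2\<close>; so 0 belongs to \<open>B\<close> and
  all of \<open>B\<close> lies below \<open>r\<close>.
\<close>

lemma obs_diam_enlargement:
  fixes M :: "'b metric" and \<nu> :: "'b measure"
  assumes "prob_space \<nu>" and space: "space \<nu> = mspace M"
    and meas: "\<And>f :: 'b \<Rightarrow> real. (\<And>x y. x \<in> mspace M \<Longrightarrow> y \<in> mspace M \<Longrightarrow> \<bar>f x - f y\<bar> \<le> mdist M x y) \<Longrightarrow>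
      f \<in> borel_measurable \<nu>"
    and obs: "obs_diam M \<nu> t < ennreal r" and t: "t < 1 / 2"
    and A: "A \<in> sets \<nu>" "measure \<nu> A \<ge> 1 / 2"
  shows "\<exists>E\<in>sets \<nu>. measure \<nu> E \<ge> 1 - t \<and> (\<forall>x\<in>E. \<exists>y\<in>A. mdist M x y < r)"
proof -
  interpret prob_space \<nu> by fact
  have AM: "A \<subseteq> mspace M" using sets.sets_into_space[OF A(1)] space by simp
  have ne: "A \<noteq> {}" using A(2) by auto
  define F where "F x = (INF y\<in>A. mdist M x y)" for x
  have bdd: "bdd_below ((\<lambda>y. mdist M x y) ` A)" for x by (rule bdd_belowI2[where m = 0]) simp
  have F_le: "F x \<le> F y + mdist M x y" if x: "x \<in> mspace M" and y: "y \<in> mspace M" for x y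
  proof -
    have "F x - mdist M x y \<le> mdist M y z" if z: "z \<in> A" for z
    proof -
      have "F x \<le> mdist M x z" unfolding F_def using z bdd by (rule cINF_lower[rotated])
      also have "\<dots> \<le> mdist M x y + mdist M y z" using x y z AM by (intro mdist_triangle) auto
      finally show ?thesis by simp
    qed
    then have "F x - mdist M x y \<le> F y" unfolding F_def[of y] using ne by (intro cINF_greatest)
    then show ?thesis by simp
  qed
  have F_lip: "\<bar>F x - F y\<bar> \<le> mdist M x y" if "x \<in> mspace M" "y \<in> mspace M" for x y
    using F_le[OF that] F_le[OF that(2,1)] mdist_commute[of M x y] by linarith
  have Fm [measurable]: "F \<in> borel_measurable \<nu>" using F_lip by (rule meas)
  have "part_diam euclidean_metric (distr \<nu> borel F) t \<le> obs_diam M \<nu> t"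
    unfolding obs_diam_def using F_lip by (intro SUP_upper) auto
  also have "\<dots> < ennreal r" by (rule obs)
  finally obtain B where B: "B \<in> sets borel" "1 - t \<le> measure (distr \<nu> borel F) B"
    "ediam euclidean_metric B < ennreal r"
    unfolding part_diam_def by (auto simp: INF_less_iff)
  define E where "E = F -` B \<inter> space \<nu>"
  have E: "E \<in> sets \<nu>" "1 - t \<le> measure \<nu> E"
    using B by (auto simp: E_def measure_distr)
  have "E \<inter> A \<noteq> {}"
  proof
    assume "E \<inter> A = {}"
    then have "measure \<nu> (E \<union> A) = measure \<nu> E + measure \<nu> A" by (intro finite_measure_Union E A)
    moreover have "measure \<nu> (E \<union> A) \<le> 1" by simp
    ultimately show False using E(2) A(2) t by linarith
  qed
  then obtain x0 where x0: "x0 \<in> E" "x0 \<in> A" by auto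
  have "F x0 \<le> mdist M x0 x0" unfolding F_def using x0(2) bdd by (rule cINF_lower[rotated])
  also have "mdist M x0 x0 = 0" using x0 AM by auto
  finally have "F x0 \<le> 0" .
  moreover have "0 \<le> F x0" unfolding F_def using ne by (intro cINF_greatest) auto
  ultimately have zero: "0 \<in> B" using x0(1) by (simp add: E_def)
  have "\<exists>y\<in>A. mdist M x y < r" if x: "x \<in> E" for x
  proof -
    have "F x \<in> B" using x by (simp add: E_def)
    with zero have "ennreal (dist (F x) 0) \<le> ediam euclidean_metric B"
      unfolding ediam_def by (intro SUP_upper2[of "F x"] SUP_upper2[of 0]) auto
    also note B(3)
    finally have "F x < r" by (auto simp: ennreal_less_iff)
    then show ?thesis unfolding F_def using ne bdd by (subst (asm) cInf_less_iff) auto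
  qed
  with E show ?thesis by blast
qed

context polish_prob begin

text \<open>
  One sequence space carries all sample sizes, as limit theorems need. Finite powers are images of it.
\<close>

abbreviation iid :: "(nat \<Rightarrow> 'a) measure" where "iid \<equiv> PiM UNIV (\<lambda>_. \<mu>)"

lemma indep_vars_iid:
  assumes g: "g \<in> borel_measurable \<mu>"
  shows "prob_space.indep_vars iid (\<lambda>_. borel) (\<lambda>i \<omega>. g (\<omega> i)) UNIV"
proof -
  have comp: "distr iid \<mu> (\<lambda>\<omega>. \<omega> i) = \<mu>" for i :: nat
    by (rule distr_PiM_component) (unfold_locales, simp)
  have "prob_space.indep_vars iid (\<lambda>_. \<mu>) (\<lambda>i \<omega>. \<omega> i) UNIV"
    by (subst prob_space.indep_vars_iff_distr_eq_PiM[OF prob_space_power]) (simp_all add: comp restrict_UNIV)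
  from prob_space.indep_vars_compose2[OF prob_space_power this, where Y = "\<lambda>_. g" and N = "\<lambda>_. borel"] g
  show ?thesis by simp
qed

lemma distr_iid_component:
  assumes [measurable]: "g \<in> borel_measurable \<mu>"
  shows "distr iid borel (\<lambda>\<omega>. g (\<omega> i)) = distr \<mu> borel g"
proof -
  have "distr iid \<mu> (\<lambda>\<omega>. \<omega> i) = \<mu>"
    by (rule distr_PiM_component) (unfold_locales, simp)
  then have "distr \<mu> borel g = distr (distr iid \<mu> (\<lambda>\<omega>. \<omega> i)) borel g" by simp
  also have "\<dots> = distr iid borel (\<lambda>\<omega>. g (\<omega> i))" by (subst distr_distr) (simp_all add: comp_def)
  finally show ?thesis ..
qed

lemma integral_iid_component:
  fixes g :: "'a \<Rightarrow> real"
  assumes [measurable]: "g \<in> borel_measurable \<mu>"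
  shows "(\<integral>\<omega>. g (\<omega> i) \<partial>iid) = (\<integral>x. g x \<partial>\<mu>)"
proof -
  have "(\<integral>\<omega>. g (\<omega> i) \<partial>iid) = (\<integral>u. u \<partial>distr iid borel (\<lambda>\<omega>. g (\<omega> i)))"
    by (subst integral_distr) simp_all
  also have "\<dots> = (\<integral>x. g x \<partial>\<mu>)"
    unfolding distr_iid_component[OF assms] by (subst integral_distr) simp_all
  finally show ?thesis .
qed

lemma measure_power_eq_iid:
  assumes A: "{x \<in> space (PiM {1..n} (\<lambda>_. \<mu>)). Q (\<Sum>i\<in>{1..n}. g (x i))} \<in> sets (PiM {1..n} (\<lambda>_. \<mu>))"
  shows "measure (PiM {1..n} (\<lambda>_. \<mu>)) {x \<in> space (PiM {1..n} (\<lambda>_. \<mu>)). Q (\<Sum>i\<in>{1..n}. g (x i))} =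
    measure iid {\<omega> \<in> space iid. Q (\<Sum>i<n. g (\<omega> i))}"
proof -
  let ?s = "\<lambda>\<omega>. \<lambda>i\<in>{1..n}. \<omega> (i - 1)"
  have d: "distr iid (PiM {1..n} (\<lambda>_. \<mu>)) ?s = PiM {1..n} (\<lambda>_. \<mu>)"
    by (rule distr_PiM_reindex) (unfold_locales, auto simp: inj_on_def)
  have s: "?s \<in> measurable iid (PiM {1..n} (\<lambda>_. \<mu>))" by measurable
  have "(\<Sum>i\<in>{1..n}. g (?s \<omega> i)) = (\<Sum>i<n. g (\<omega> i))" for \<omega>
    by (simp add: sum.atLeast1_atMost_eq)
  then have "?s -` {x \<in> space (PiM {1..n} (\<lambda>_. \<mu>)). Q (\<Sum>i\<in>{1..n}. g (x i))} \<inter> space iid =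
      {\<omega> \<in> space iid. Q (\<Sum>i<n. g (\<omega> i))}"
    using measurable_space[OF s] by (auto simp del: space_power)
  then show ?thesis
    by (subst (1) d[symmetric], subst measure_distr[OF s A]) simp
qed

lemma central_limit_sums:
  assumes f [measurable]: "f \<in> borel_measurable \<mu>" and B: "\<And>x. \<bar>f x\<bar> \<le> B" and v: "0 < real_variance \<mu> f"
  shows "(\<lambda>n. measure iid {\<omega>\<in>space iid. (\<Sum>i<n. f (\<omega> i) - expectation f) \<le> a * sqrt (real n)})
    \<longlonglongrightarrow> 1 - Phi_bar (a / sqrt (real_variance \<mu> f))"
proof -
  define \<sigma> where "\<sigma> = sqrt (real_variance \<mu> f)"
  have \<sigma>: "\<sigma> > 0" "\<sigma>\<^sup>2 = real_variance \<mu> f" using v by (simp_all add: \<sigma>_def)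
  define g where "g x = f x - expectation f" for x
  have gm [measurable]: "g \<in> borel_measurable \<mu>" unfolding g_def by measurable
  have gB: "\<bar>g x\<bar> \<le> 2 * B" for x
    using B[of x] abs_integral_bounded[where h = f, OF prob_space_axioms B] unfolding g_def by linarith
  have mean: "(\<integral>\<omega>. g (\<omega> i) \<partial>iid) = 0" for i
    using integrable_bounded[OF f B] by (subst integral_iid_component) (use prob_space in \<open>simp_all add: g_def[abs_def]\<close>)
  have var: "(\<integral>\<omega>. (g (\<omega> i))\<^sup>2 \<partial>iid) = \<sigma>\<^sup>2" for i
    by (subst integral_iid_component[where g = "\<lambda>x. (g x)\<^sup>2"]) (simp_all add: \<sigma> real_variance_eq[OF f B] g_def)
  have "weak_conv_m (\<lambda>n. distr iid borel (\<lambda>\<omega>. (\<Sum>i<n. g (\<omega> i)) / sqrt (real n * \<sigma>\<^sup>2))) std_normal_distribution"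
  proof (rule prob_space.central_limit_theorem_zero_mean[OF prob_space_power indep_vars_iid[OF gm] mean \<sigma>(1)])
    show "integrable iid (\<lambda>\<omega>. (g (\<omega> n))\<^sup>2)" for n
      by (rule prob_space.integrable_bounded[OF prob_space_power, where B = "(2 * B)\<^sup>2"]) (measurable, rule abs_power2_le, rule gB)
    show "(\<integral>\<omega>. (g (\<omega> n) - (\<integral>\<omega>. g (\<omega> n) \<partial>iid))\<^sup>2 \<partial>iid) = \<sigma>\<^sup>2" for n by (simp add: mean var)
    show "distr iid borel (\<lambda>\<omega>. g (\<omega> n)) = distr \<mu> borel g" for n by (rule distr_iid_component[OF gm])
  qed
  then have "(\<lambda>n. cdf (distr iid borel (\<lambda>\<omega>. (\<Sum>i<n. g (\<omega> i)) / sqrt (real n * \<sigma>\<^sup>2))) (a / \<sigma>))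
      \<longlonglongrightarrow> cdf std_normal_distribution (a / \<sigma>)"
    by (simp add: weak_conv_m_def weak_conv_def isCont_cdf_std_normal)
  then show ?thesis
    unfolding cdf_std_normal \<sigma>_def[symmetric]
  proof (rule Lim_transform_eventually)
    show "\<forall>\<^sub>F n in sequentially. cdf (distr iid borel (\<lambda>\<omega>. (\<Sum>i<n. g (\<omega> i)) / sqrt (real n * \<sigma>\<^sup>2))) (a / \<sigma>)
      = measure iid {\<omega>\<in>space iid. (\<Sum>i<n. f (\<omega> i) - expectation f) \<le> a * sqrt (real n)}"
      using eventually_gt_at_top[of 0]
    proof eventually_elim
      case (elim n)
      have "(\<Sum>i<n. g (\<omega> i)) / sqrt (real n * \<sigma>\<^sup>2) \<le> a / \<sigma> \<longleftrightarrow> (\<Sum>i<n. g (\<omega> i)) \<le> a * sqrt (real n)" for \<omega>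
        using elim \<sigma>(1) by (simp add: real_sqrt_mult field_simps)
      then have "(\<lambda>\<omega>. (\<Sum>i<n. g (\<omega> i)) / sqrt (real n * \<sigma>\<^sup>2)) -` {..a / \<sigma>} \<inter> space iid
          = {\<omega>\<in>space iid. (\<Sum>i<n. g (\<omega> i)) \<le> a * sqrt (real n)}"
        by auto
      then show ?case
        unfolding cdf_def by (subst measure_distr) (simp_all add: g_def)
    qed
  qed
qed

text \<open>
  Hoeffding's inequality gives exponential decay.
\<close>

lemma law_of_large_numbers:
  assumes Y [measurable]: "Y \<in> borel_measurable \<mu>" and B: "\<And>x. 0 \<le> Y x" "\<And>x. Y x \<le> B" and \<eta>: "0 < \<eta>"
  shows "(\<lambda>n. measure iid {\<omega>\<in>space iid. (\<Sum>i<n. Y (\<omega> i)) \<ge> real n * (expectation Y + \<eta>)}) \<longlonglongrightarrow> 0"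
proof -
  define C where "C = B + 1"
  have C: "0 < C" "Y x \<le> C" for x using B(1)[of x] B(2)[of x] by (simp_all add: C_def)
  define \<kappa> where "\<kappa> = 2 * \<eta>\<^sup>2 / C\<^sup>2"
  have \<kappa>: "\<kappa> > 0" using C \<eta> by (simp add: \<kappa>_def)
  have bound: "measure iid {\<omega>\<in>space iid. (\<Sum>i<n. Y (\<omega> i)) \<ge> real n * (expectation Y + \<eta>)} \<le> exp (- \<kappa>) ^ n"
    if n: "n > 0" for n
  proof -
    interpret H: Hoeffding_ineq iid "{..<n}" "\<lambda>i \<omega>. Y (\<omega> i)" "\<lambda>_. 0" "\<lambda>_. C" "\<Sum>i<n. (\<integral>\<omega>. Y (\<omega> i) \<partial>iid)"
    proof unfold_locales
      show "prob_space.indep_vars iid (\<lambda>_. borel) (\<lambda>i \<omega>. Y (\<omega> i)) {..<n}"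
        by (rule prob_space.indep_vars_subset[OF prob_space_power indep_vars_iid[OF Y]]) simp
    qed (use B C in auto)
    have mean: "(\<Sum>i<n. (\<integral>\<omega>. Y (\<omega> i) \<partial>iid)) = real n * expectation Y"
      by (simp add: integral_iid_component[OF Y])
    have "measure iid {\<omega>\<in>space iid. (\<Sum>i<n. Y (\<omega> i)) \<ge> real n * expectation Y + real n * \<eta>}
        \<le> exp (- 2 * (real n * \<eta>)\<^sup>2 / (\<Sum>i<n. (C - 0)\<^sup>2))"
      unfolding mean[symmetric] by (rule H.Hoeffding_ineq_ge) (use \<eta> C n in auto)
    also have "- 2 * (real n * \<eta>)\<^sup>2 / (\<Sum>i<n. (C - 0)\<^sup>2) = real n * (- \<kappa>)"
      using n C by (simp add: \<kappa>_def power2_eq_square field_simps)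
    also have "exp (real n * (- \<kappa>)) = exp (- \<kappa>) ^ n" by (rule exp_of_nat_mult)
    finally show ?thesis by (simp add: algebra_simps)
  qed
  have "(\<lambda>n. exp (- \<kappa>) ^ n) \<longlonglongrightarrow> 0" using \<kappa> by (intro LIMSEQ_power_zero) simp
  then show ?thesis
  proof (rule Lim_null_comparison[rotated])
    show "\<forall>\<^sub>F n in sequentially. norm (measure iid {\<omega>\<in>space iid. (\<Sum>i<n. Y (\<omega> i)) \<ge> real n * (expectation Y + \<eta>)}) \<le> exp (- \<kappa>) ^ n"
      using eventually_gt_at_top[of 0] by eventually_elim (use bound in simp)
  qed
qed

text \<open>
  At distances below \<open>\<rho>\<close> this is the inequality of arithmetic and geometric means applied to slope times
  distance. At larger distances the quadratic term alone exceeds the Lipschitz bound, because \<open>2 s L \<le> \<rho>\<close>.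
  In other words the infimum of \<open>f y + d(x,y)\<^sup>2 / (2 s)\<close> over \<open>y\<close>, the Hopf-Lax evolution of \<open>f\<close> at time \<open>s\<close>,
  is at least \<open>f x - s G(x)\<^sup>2 / 2\<close> for the slope \<open>G\<close>.
\<close>

lemma descent_quadratic_bound:
  assumes lip: "\<And>x y. x \<in> mspace m \<Longrightarrow> y \<in> mspace m \<Longrightarrow> \<bar>f x - f y\<bar> \<le> L * mdist m x y" and L: "0 \<le> L"
    and x: "x \<in> mspace m" and y: "y \<in> mspace m" and s: "0 < s" "2 * s * L \<le> \<rho>"
  shows "f x - f y \<le> s / 2 * (enn2real (descent_slope m f \<rho> x))\<^sup>2 + (mdist m x y)\<^sup>2 / (2 * s)"
proof -
  define d where "d = mdist m x y"
  define G where "G = enn2real (descent_slope m f \<rho> x)"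
  have d0: "d \<ge> 0" by (simp add: d_def)
  consider "d = 0" | "0 < d" "d < \<rho>" | "\<rho> \<le> d" using d0 by linarith
  then have "f x - f y \<le> s / 2 * G\<^sup>2 + d\<^sup>2 / (2 * s)"
  proof cases
    case 1
    then have "x = y" using x y by (simp add: d_def)
    with s show ?thesis by simp
  next
    case 2
    have le: "descent_slope m f \<rho> x \<le> ennreal L"
      using lip x L by (intro descent_slope_le) (auto simp: mdist_commute abs_le_iff)
    then have G: "descent_slope m f \<rho> x = ennreal G"
      using le_less_trans[OF le ennreal_less_top] by (simp add: G_def)
    have "ennreal (max (f x - f y) 0 / mdist m y x) \<le> ennreal G"
      unfolding G[symmetric] descent_slope_def using 2 y
      by (intro SUP_upper) (simp add: d_def mdist_commute)
    then have "max (f x - f y) 0 / d \<le> G"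
      by (subst (asm) ennreal_le_iff) (auto simp: G_def d_def mdist_commute)
    then have "f x - f y \<le> G * d" using 2 by (simp add: divide_le_eq)
    also have "\<dots> \<le> s / 2 * G\<^sup>2 + d\<^sup>2 / (2 * s)"
    proof -
      have "0 \<le> (s * G - d)\<^sup>2 / (2 * s)" using s by simp
      also have "\<dots> = s / 2 * G\<^sup>2 + d\<^sup>2 / (2 * s) - G * d"
        using s by (simp add: power2_eq_square field_simps)
      finally show ?thesis by simp
    qed
    finally show ?thesis .
  next
    case 3
    have "f x - f y \<le> L * d" using lip[OF x y] by (simp add: d_def)
    also have "\<dots> = d * (2 * s * L) / (2 * s)" using s by simp
    also have "\<dots> \<le> d * d / (2 * s)"
      using s 3 d0 by (intro divide_right_mono mult_left_mono) auto
    also have "\<dots> \<le> s / 2 * G\<^sup>2 + d\<^sup>2 / (2 * s)" using s by (simp add: power2_eq_square)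
    finally show ?thesis .
  qed
  then show ?thesis by (simp add: G_def d_def)
qed

lemma power_enlargement:
  fixes n :: nat
  assumes n: "1 \<le> n" and r: "r_infty m \<mu> t < ennreal r" and t: "t < 1 / 2"
    and A: "A \<in> sets (PiM {1..n} (\<lambda>_. \<mu>))" "measure (PiM {1..n} (\<lambda>_. \<mu>)) A \<ge> 1 / 2"
  shows "\<exists>E\<in>sets (PiM {1..n} (\<lambda>_. \<mu>)). measure (PiM {1..n} (\<lambda>_. \<mu>)) E \<ge> 1 - t \<and>
    (\<forall>x\<in>E. \<exists>y\<in>A. pdist {1..n} x y < r)"
proof -
  have "obs_diam (power_metric n m) (PiM {1..n} (\<lambda>_. \<mu>)) t \<le> r_infty m \<mu> t"
    unfolding r_infty_def using n by (intro SUP_upper) auto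
  also note r
  finally have obs: "obs_diam (power_metric n m) (PiM {1..n} (\<lambda>_. \<mu>)) t < ennreal r" .
  have "\<exists>E\<in>sets (PiM {1..n} (\<lambda>_. \<mu>)). measure (PiM {1..n} (\<lambda>_. \<mu>)) E \<ge> 1 - t \<and>
    (\<forall>x\<in>E. \<exists>y\<in>A. mdist (power_metric n m) x y < r)"
  proof (rule obs_diam_enlargement[OF prob_space_power _ _ obs t A])
    fix f :: "(nat \<Rightarrow> 'a) \<Rightarrow> real"
    assume "\<And>x y. x \<in> mspace (power_metric n m) \<Longrightarrow> y \<in> mspace (power_metric n m) \<Longrightarrow>
      \<bar>f x - f y\<bar> \<le> mdist (power_metric n m) x y"
    then show "f \<in> borel_measurable (PiM {1..n} (\<lambda>_. \<mu>))"
      by (intro borel_measurable_lipschitz_power[where L = 1]) (simp_all add: L2_set_def)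
  qed simp
  then show ?thesis by (simp add: L2_set_def)
qed

lemma enn2real_descent_slope_le:
  assumes lip: "\<And>x y. x \<in> mspace m \<Longrightarrow> y \<in> mspace m \<Longrightarrow> \<bar>f x - f y\<bar> \<le> L * mdist m x y" and L: "0 \<le> L"
    and x: "x \<in> mspace m"
  shows "descent_slope m f \<rho> x \<le> ennreal L" "enn2real (descent_slope m f \<rho> x) \<le> L"
proof -
  show "descent_slope m f \<rho> x \<le> ennreal L"
    using lip x L by (intro descent_slope_le) (auto simp: mdist_commute abs_le_iff)
  from enn2real_mono[OF this] L show "enn2real (descent_slope m f \<rho> x) \<le> L" by simp
qed

text \<open>
  The core of the converse. The set \<open>A\<close> of samples with \<open>\<Sum>(f(x i) - e) \<le> \<eta> sqrt n\<close> has measure above \<open>1/2\<close>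
  for large \<open>n\<close>, so its \<open>r\<close>-neighbourhood has measure at least \<open>1 - t\<close>. By \<open>descent_quadratic_bound\<close> a point of
  this neighbourhood satisfies \<open>\<Sum>(f(x i) - e) \<le> u sqrt n\<close>, unless its mean squared slope exceeds the
  expectation by at least \<open>\<eta>\<close>. In the limit \<open>1 - t \<le> 1 - Phi_bar (u / \<sigma>)\<close>.
\<close>

lemma variance_le_at_scale:
  assumes t: "0 < t" "t < 1 / 2" and r: "r_infty m \<mu> t < ennreal r"
    and lip: "\<And>x y. x \<in> mspace m \<Longrightarrow> y \<in> mspace m \<Longrightarrow> \<bar>f x - f y\<bar> \<le> L * mdist m x y" and L: "0 \<le> L"
    and B: "\<And>x. \<bar>f x\<bar> \<le> B" and \<rho>: "0 < \<rho>" and \<theta>: "0 < \<theta>"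
  shows "sqrt (real_variance \<mu> f) * inv Phi_bar t \<le>
    r\<^sup>2 / (2 * \<theta>) + \<theta> / 2 * (\<integral>x. (enn2real (descent_slope m f \<rho> x))\<^sup>2 \<partial>\<mu>)"
proof -
  define G where "G x = enn2real (descent_slope m f \<rho> x)" for x
  define E where "E = (\<integral>x. (G x)\<^sup>2 \<partial>\<mu>)"
  define e where "e = expectation f"
  have r0: "0 < r"
  proof (rule ccontr)
    assume "\<not> 0 < r" then have "ennreal r = 0" by (simp add: ennreal_neg)
    with r show False by simp
  qed
  have E0: "0 \<le> E" by (simp add: E_def)
  have f [measurable]: "f \<in> borel_measurable \<mu>" using lip L by (rule borel_measurable_lipschitz)
  have Gm [measurable]: "G \<in> borel_measurable \<mu>"
    unfolding G_def using measurable_descent_slope[OF lip L] by measurable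
  have GL: "0 \<le> G x" "x \<in> mspace m \<Longrightarrow> G x \<le> L" for x
    using enn2real_descent_slope_le(2)[OF lip L] by (auto simp: G_def)
  have v0: "0 \<le> real_variance \<mu> f"
    using real_variance_eq[OF f B] by simp
  show ?thesis
  proof (cases "real_variance \<mu> f = 0")
    case True
    with \<theta> E0 show ?thesis by (simp add: E_def G_def)
  next
    case False
    with v0 have v: "0 < real_variance \<mu> f" by simp
    define \<sigma> where "\<sigma> = sqrt (real_variance \<mu> f)"
    have \<sigma>: "\<sigma> > 0" using v by (simp add: \<sigma>_def)
    have "\<sigma> * inv Phi_bar t \<le> r\<^sup>2 / (2 * \<theta>) + \<theta> / 2 * E + \<eta> * (1 + \<theta> / 2)" if \<eta>: "0 < \<eta>" for \<eta>
    proof -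
      define u where "u = \<eta> + r\<^sup>2 / (2 * \<theta>) + \<theta> / 2 * (E + \<eta>)"
      \<comment> \<open>Truncation makes \<open>Y\<close> bounded on the whole type; on the carrier it agrees with \<open>G\<^sup>2\<close>.\<close>
  define Y where "Y x = min (L\<^sup>2) ((G x)\<^sup>2)" for x
      have YG: "Y x = (G x)\<^sup>2" if "x \<in> mspace m" for x
        using GL(1)[of x] GL(2)[OF that] by (auto simp: Y_def min_def power2_le_iff_abs_le)
      have EY: "expectation Y = E"
        unfolding E_def by (intro Bochner_Integration.integral_cong refl) (simp add: YG)
      have Ym [measurable]: "Y \<in> borel_measurable \<mu>" unfolding Y_def by measurable
      let ?S = "\<lambda>n a. measure iid {\<omega>\<in>space iid. (\<Sum>i<n. f (\<omega> i) - e) \<le> a * sqrt (real n)}"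
      let ?T = "\<lambda>n. measure iid {\<omega>\<in>space iid. (\<Sum>i<n. Y (\<omega> i)) \<ge> real n * (E + \<eta>)}"
      have clt: "(\<lambda>n. ?S n a) \<longlonglongrightarrow> 1 - Phi_bar (a / \<sigma>)" for a
        unfolding e_def \<sigma>_def by (rule central_limit_sums[OF f B v])
      have lln: "?T \<longlonglongrightarrow> 0"
        using law_of_large_numbers[OF Ym _ _ \<eta>, of "L\<^sup>2"] unfolding EY by (simp add: Y_def)
      have "Phi_bar (\<eta> / \<sigma>) < 1 / 2"
        using Phi_bar_strict_antimono[of 0 "\<eta> / \<sigma>"] \<eta> \<sigma> by (simp add: Phi_bar_0)
      then have "\<forall>\<^sub>F n in sequentially. 1 / 2 < ?S n \<eta>"
        by (intro order_tendstoD(1)[OF clt]) simp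
      moreover have "\<forall>\<^sub>F n in sequentially. 2 * \<theta> * L / \<rho> \<le> sqrt (real n)"
        using filterlim_compose[OF sqrt_at_top filterlim_real_sequentially]
        by (simp add: filterlim_at_top)
      ultimately have "\<forall>\<^sub>F n in sequentially. 1 - t \<le> ?T n + ?S n u"
        using eventually_gt_at_top[of 0]
      proof eventually_elim
        case (elim n)
        let ?P = "PiM {1..n} (\<lambda>_. \<mu>)"
        define A where "A = {x \<in> space ?P. (\<Sum>i\<in>{1..n}. f (x i) - e) \<le> \<eta> * sqrt (real n)}"
        define U where "U = {x \<in> space ?P. (\<Sum>i\<in>{1..n}. f (x i) - e) \<le> u * sqrt (real n)}"
        define T where "T = {x \<in> space ?P. (\<Sum>i\<in>{1..n}. Y (x i)) \<ge> real n * (E + \<eta>)}"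
        have A: "A \<in> sets ?P" and U: "U \<in> sets ?P" and T: "T \<in> sets ?P"
          unfolding A_def U_def T_def by measurable
        have mA: "measure ?P A = ?S n \<eta>"
          unfolding A_def using A[unfolded A_def]
          by (rule measure_power_eq_iid[where g = "\<lambda>x. f x - e" and Q = "\<lambda>s. s \<le> \<eta> * sqrt (real n)"])
        have mU: "measure ?P U = ?S n u"
          unfolding U_def using U[unfolded U_def]
          by (rule measure_power_eq_iid[where g = "\<lambda>x. f x - e" and Q = "\<lambda>s. s \<le> u * sqrt (real n)"])
        have mT: "measure ?P T = ?T n"
          unfolding T_def using T[unfolded T_def]
          by (rule measure_power_eq_iid[where g = Y and Q = "\<lambda>s. s \<ge> real n * (E + \<eta>)"])
        obtain H where H: "H \<in> sets ?P" "measure ?P H \<ge> 1 - t" "\<And>x. x \<in> H \<Longrightarrow> \<exists>y\<in>A. pdist {1..n} x y < r"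
          using power_enlargement[OF _ r t(2) A] elim mA by auto
        \<comment> \<open>The time scale at which the Gaussian fluctuations of order \<open>sqrt n\<close> balance the slope term of order
          \<open>s n\<close> and the transport term of order \<open>1 / s\<close>.\<close>
        define s where "s = \<theta> / sqrt (real n)"
        have s: "0 < s" "2 * s * L \<le> \<rho>"
          using \<theta> elim \<rho> by (auto simp: s_def field_simps)
        have "H \<subseteq> T \<union> U"
        proof
          fix x assume xH: "x \<in> H"
          then have x: "x \<in> space ?P" using sets.sets_into_space[OF H(1)] by auto
          obtain y where y: "y \<in> A" "pdist {1..n} x y < r" using H(3)[OF xH] by auto
          have y': "y \<in> space ?P" using y(1) by (simp add: A_def)
          have xi: "x i \<in> mspace m" "y i \<in> mspace m" if "i \<in> {1..n}" for i
            using x y' that by (auto simp: PiE_iff)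
          show "x \<in> T \<union> U"
          proof (cases "x \<in> T")
            case False
            then have YT: "(\<Sum>i\<in>{1..n}. Y (x i)) \<le> real n * (E + \<eta>)" using x by (simp add: T_def)
            have "(\<Sum>i\<in>{1..n}. f (x i) - e) - (\<Sum>i\<in>{1..n}. f (y i) - e) = (\<Sum>i\<in>{1..n}. f (x i) - f (y i))"
              by (simp add: sum_subtractf)
            also have "\<dots> \<le> (\<Sum>i\<in>{1..n}. s / 2 * Y (x i) + (mdist m (x i) (y i))\<^sup>2 / (2 * s))"
              using descent_quadratic_bound[OF lip L _ _ s] xi by (intro sum_mono) (simp add: YG G_def)
            also have "\<dots> = s / 2 * (\<Sum>i\<in>{1..n}. Y (x i)) + (pdist {1..n} x y)\<^sup>2 / (2 * s)"
              by (simp add: sum.distrib sum_distrib_left sum_divide_distrib[symmetric] L2_set_def sum_nonneg)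
            also have "\<dots> \<le> s / 2 * (real n * (E + \<eta>)) + r\<^sup>2 / (2 * s)"
              using YT y(2) s by (intro add_mono mult_left_mono divide_right_mono power_mono) (auto simp: L2_set_nonneg)
            also have "\<dots> = \<theta> / 2 * (E + \<eta>) * sqrt (real n) + r\<^sup>2 / (2 * \<theta>) * sqrt (real n)"
            proof -
              have "real n = sqrt (real n) * sqrt (real n)" by simp
              then have "s * real n = \<theta> * sqrt (real n)"
                using elim unfolding s_def by (metis nonzero_mult_div_cancel_right times_divide_eq_left
                    mult.assoc of_nat_0_less_iff real_sqrt_gt_zero less_irrefl nonzero_eq_divide_eq)
              moreover have "r\<^sup>2 / (2 * s) = r\<^sup>2 / (2 * \<theta>) * sqrt (real n)" by (simp add: s_def)
              moreover have "s / 2 * (real n * (E + \<eta>)) = s * real n * ((E + \<eta>) / 2)" by simp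
              ultimately show ?thesis by simp
            qed
            finally have "(\<Sum>i\<in>{1..n}. f (x i) - e) \<le> u * sqrt (real n)"
              using y(1) by (simp add: A_def u_def algebra_simps)
            then show ?thesis using x by (simp add: U_def)
          qed simp
        qed
        then have "measure ?P H \<le> measure ?P (T \<union> U)" using T U by (intro power.finite_measure_mono) auto
        also have "\<dots> \<le> measure ?P T + measure ?P U" using T U by (rule measure_Un_le)
        finally show ?case using H(2) by (simp only: mT mU)
      qed
      moreover have "(\<lambda>n. ?T n + ?S n u) \<longlonglongrightarrow> 0 + (1 - Phi_bar (u / \<sigma>))"
        by (intro tendsto_add lln clt)
      ultimately have "1 - t \<le> 0 + (1 - Phi_bar (u / \<sigma>))"
        by (intro tendsto_lowerbound[of _ _ sequentially]) auto
      then have "inv Phi_bar t \<le> u / \<sigma>" using t by (intro inv_Phi_bar_le) auto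
      then have "\<sigma> * inv Phi_bar t \<le> u" using \<sigma> by (simp add: field_simps)
      also have "u = r\<^sup>2 / (2 * \<theta>) + \<theta> / 2 * E + \<eta> * (1 + \<theta> / 2)" by (simp add: u_def algebra_simps)
      finally show ?thesis .
    qed
    note step = this
    have "\<sigma> * inv Phi_bar t \<le> r\<^sup>2 / (2 * \<theta>) + \<theta> / 2 * E"
    proof (rule field_le_epsilon)
      fix \<epsilon> :: real assume \<epsilon>: "\<epsilon> > 0"
      have "\<epsilon> / (1 + \<theta> / 2) * (1 + \<theta> / 2) = \<epsilon>" using \<theta> by simp
      then show "\<sigma> * inv Phi_bar t \<le> r\<^sup>2 / (2 * \<theta>) + \<theta> / 2 * E + \<epsilon>"
        using step[of "\<epsilon> / (1 + \<theta> / 2)"] \<epsilon> \<theta> by simp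
    qed
    then show ?thesis by (simp add: \<sigma>_def E_def G_def)
  qed
qed

text \<open>
  Dominated convergence as the scale tends to 0, then the choice of \<open>\<theta>\<close> that minimises the bound.
\<close>

lemma variance_le_integral_grad_minus:
  assumes t: "0 < t" "t < 1 / 2" and r: "r_infty m \<mu> t < ennreal r"
    and lip: "\<And>x y. x \<in> mspace m \<Longrightarrow> y \<in> mspace m \<Longrightarrow> \<bar>f x - f y\<bar> \<le> L * mdist m x y" and L: "0 \<le> L"
    and B: "\<And>x. \<bar>f x\<bar> \<le> B"
  shows "ennreal ((inv Phi_bar t / r)\<^sup>2 * real_variance \<mu> f) \<le> (\<integral>\<^sup>+x. (grad_minus m f x)\<^sup>2 \<partial>\<mu>)"
proof -
  define q where "q = inv Phi_bar t"
  define \<sigma> where "\<sigma> = sqrt (real_variance \<mu> f)"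
  define G where "G k x = enn2real (descent_slope m f (1 / real (Suc k)) x)" for k x
  define g where "g x = enn2real (grad_minus m f x)" for x
  define \<gamma> where "\<gamma> = (\<integral>x. (g x)\<^sup>2 \<partial>\<mu>)"
  have q: "q > 0" unfolding q_def by (rule inv_Phi_bar_pos[OF t])
  have r0: "0 < r"
  proof (rule ccontr)
    assume "\<not> 0 < r" then have "ennreal r = 0" by (simp add: ennreal_neg)
    with r show False by simp
  qed
  have f: "f \<in> borel_measurable \<mu>" using lip L by (rule borel_measurable_lipschitz)
  have \<sigma>: "0 \<le> \<sigma>" "\<sigma>\<^sup>2 = real_variance \<mu> f"
    using real_variance_eq[OF f B] by (simp_all add: \<sigma>_def)
  have slope_m [measurable]: "descent_slope m f \<rho> \<in> borel_measurable \<mu>" for \<rho>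
    by (rule measurable_descent_slope[OF lip L])
  have Gm [measurable]: "G k \<in> borel_measurable \<mu>" for k
    unfolding G_def by measurable
  have GL: "\<bar>G k x\<bar> \<le> L" if "x \<in> mspace m" for k x
    using enn2real_descent_slope_le(2)[OF lip L that] by (simp add: G_def)
  have grad_le: "grad_minus m f x \<le> ennreal L" if "x \<in> mspace m" for x
    using order_trans[OF grad_minus_le_descent_slope enn2real_descent_slope_le(1)[OF lip L that]] that
    by (meson zero_less_one)
  have grad_eq: "grad_minus m f x = ennreal (g x)" if "x \<in> mspace m" for x
    using le_less_trans[OF grad_le[OF that] ennreal_less_top] by (simp add: g_def)
  have g0: "0 \<le> g x" for x by (simp add: g_def)
  have lim: "(\<lambda>k. G k x) \<longlonglongrightarrow> g x" if x: "x \<in> mspace m" for x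
  proof -
    have "decseq (\<lambda>k. descent_slope m f (1 / real (Suc k)) x)"
      by (intro decseq_SucI descent_slope_mono) (simp add: field_simps)
    from LIMSEQ_INF[OF this] have "(\<lambda>k. descent_slope m f (1 / real (Suc k)) x) \<longlonglongrightarrow> ennreal (g x)"
      by (simp only: grad_eq[OF x, symmetric] grad_minus_eq_INF_descent_slope[OF x])
    then show ?thesis unfolding G_def by (rule tendsto_enn2real) (simp add: g_def)
  qed
  have gm [measurable]: "g \<in> borel_measurable \<mu>"
    by (rule borel_measurable_LIMSEQ_real[where u = G]) (use lim in auto)
  have conv: "(\<lambda>k. \<integral>x. (G k x)\<^sup>2 \<partial>\<mu>) \<longlonglongrightarrow> \<gamma>"
    unfolding \<gamma>_def
  proof (rule integral_dominated_convergence[where w = "\<lambda>_. L\<^sup>2"])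
    show "AE x in \<mu>. (\<lambda>k. (G k x)\<^sup>2) \<longlonglongrightarrow> (g x)\<^sup>2"
      by (rule AE_I2) (use lim in \<open>auto intro!: tendsto_power\<close>)
    show "AE x in \<mu>. norm ((G k x)\<^sup>2) \<le> L\<^sup>2" for k
      by (rule AE_I2) (use abs_power2_le[OF GL] in simp)
    show "(\<lambda>x. (g x)\<^sup>2) \<in> borel_measurable \<mu>" "(\<lambda>x. (G k x)\<^sup>2) \<in> borel_measurable \<mu>" for k
      by measurable
  qed simp
  have main: "\<sigma> * q \<le> r\<^sup>2 / (2 * \<theta>) + \<theta> / 2 * \<gamma>" if \<theta>: "0 < \<theta>" for \<theta>
  proof (rule LIMSEQ_le_const)
    show "(\<lambda>k. r\<^sup>2 / (2 * \<theta>) + \<theta> / 2 * (\<integral>x. (G k x)\<^sup>2 \<partial>\<mu>)) \<longlonglongrightarrow> r\<^sup>2 / (2 * \<theta>) + \<theta> / 2 * \<gamma>"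
      by (intro tendsto_add tendsto_mult tendsto_const conv)
    show "\<exists>N. \<forall>k\<ge>N. \<sigma> * q \<le> r\<^sup>2 / (2 * \<theta>) + \<theta> / 2 * (\<integral>x. (G k x)\<^sup>2 \<partial>\<mu>)"
      unfolding \<sigma>_def q_def G_def
      using variance_le_at_scale[OF t r lip L B _ \<theta>] by (intro exI allI impI) simp
  qed
  have \<gamma>0: "0 \<le> \<gamma>" by (simp add: \<gamma>_def)
  have "(\<sigma> * q)\<^sup>2 / r\<^sup>2 \<le> \<gamma>"
  proof (rule field_le_epsilon)
    fix \<epsilon> :: real assume \<epsilon>: "\<epsilon> > 0"
    \<comment> \<open>The bound is minimal for \<open>\<theta> = r / sqrt \<gamma>\<close>; the summand \<open>\<epsilon>\<close> covers the case \<open>\<gamma> = 0\<close>.\<close>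
    define w where "w = sqrt (\<gamma> + \<epsilon>)"
    have w: "w > 0" "w\<^sup>2 = \<gamma> + \<epsilon>" using \<epsilon> \<gamma>0 by (simp_all add: w_def)
    have "\<sigma> * q \<le> r\<^sup>2 / (2 * (r / w)) + (r / w) / 2 * \<gamma>" using r0 w by (intro main) simp
    also have "\<dots> \<le> r\<^sup>2 / (2 * (r / w)) + (r / w) / 2 * w\<^sup>2"
      using r0 w \<epsilon> by (intro add_left_mono mult_left_mono) auto
    also have "\<dots> = r * w" using r0 w(1) by (simp add: power2_eq_square field_simps)
    finally have "(\<sigma> * q)\<^sup>2 \<le> (r * w)\<^sup>2" using \<sigma> q by (intro power_mono) auto
    then show "(\<sigma> * q)\<^sup>2 / r\<^sup>2 \<le> \<gamma> + \<epsilon>" using r0 w(2) by (simp add: power_mult_distrib divide_le_eq mult.commute)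
  qed
  then have "ennreal ((q / r)\<^sup>2 * real_variance \<mu> f) \<le> ennreal \<gamma>"
    unfolding \<sigma>(2)[symmetric] by (intro ennreal_leI) (simp add: power_mult_distrib power_divide mult.commute)
  also have "ennreal \<gamma> = (\<integral>\<^sup>+x. ennreal ((g x)\<^sup>2) \<partial>\<mu>)"
    unfolding \<gamma>_def
  proof (rule nn_integral_eq_integral[symmetric])
    show "integrable \<mu> (\<lambda>x. (g x)\<^sup>2)"
    proof (rule integrable_const_bound[where B = "L\<^sup>2"])
      have "\<bar>g x\<bar> \<le> L" if "x \<in> mspace m" for x
        using enn2real_mono[OF grad_le[OF that]] L by (simp add: g_def)
      then show "AE x in \<mu>. norm ((g x)\<^sup>2) \<le> L\<^sup>2"
        by (intro AE_I2) (use abs_power2_le in simp)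
    qed measurable
  qed simp
  also have "\<dots> = (\<integral>\<^sup>+x. (grad_minus m f x)\<^sup>2 \<partial>\<mu>)"
    using g0 by (intro nn_integral_cong) (simp add: grad_eq ennreal_power)
  finally show ?thesis by (simp add: q_def)
qed

text \<open>
  Truncation does not increase slopes, so the variances of the truncations \<open>F k\<close> of \<open>f\<close> are uniformly
  bounded. Once their means are bounded as well, \<open>f\<close> is square integrable by Fatou's lemma and the inequality
  passes to the limit. The means are bounded because \<open>|f| \<le> N\<close> holds with probability above \<open>1/2\<close>: a mean
  far outside \<open>[-N, N]\<close> would force a large variance.
\<close>

lemma poincare_from_bounded:
  assumes c: "0 < c"
    and bounded: "\<And>f L B. (\<And>x y. x \<in> mspace m \<Longrightarrow> y \<in> mspace m \<Longrightarrow> \<bar>f x - f y\<bar> \<le> L * mdist m x y) \<Longrightarrow> 0 \<le> L \<Longrightarrow>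
      (\<And>x. \<bar>f x\<bar> \<le> B) \<Longrightarrow> ennreal (c * real_variance \<mu> f) \<le> (\<integral>\<^sup>+x. (grad_minus m f x)\<^sup>2 \<partial>\<mu>)"
  shows "poincare m \<mu> (ennreal c)"
  unfolding poincare_def
proof (intro allI impI)
  fix f :: "'a \<Rightarrow> real" assume "Lipschitz_continuous_map m euclidean_metric f"
  then obtain L where L: "0 < L" and lip: "\<And>x y. x \<in> mspace m \<Longrightarrow> y \<in> mspace m \<Longrightarrow> \<bar>f x - f y\<bar> \<le> L * mdist m x y"
    by (auto simp: Lipschitz_continuous_map_pos dist_real_def)
  define \<Gamma> where "\<Gamma> = (\<integral>\<^sup>+x. (grad_minus m f x)\<^sup>2 \<partial>\<mu>)"
  define \<gamma> where "\<gamma> = enn2real \<Gamma>"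
  have fm [measurable]: "f \<in> borel_measurable \<mu>" using lip L by (intro borel_measurable_lipschitz) auto
  have grad_le: "grad_minus m f x \<le> ennreal L" if x: "x \<in> mspace m" for x
    using order_trans[OF grad_minus_le_descent_slope enn2real_descent_slope_le(1)[OF lip _ x]] x L
    by (meson less_imp_le zero_less_one)
  have "\<Gamma> \<le> (\<integral>\<^sup>+x. (ennreal L)\<^sup>2 \<partial>\<mu>)"
    unfolding \<Gamma>_def using grad_le by (intro nn_integral_mono power_mono) auto
  also have "\<dots> = ennreal (L\<^sup>2)" using L emeasure_space_1 by (simp add: ennreal_power)
  finally have \<Gamma>: "\<Gamma> = ennreal \<gamma>" by (simp add: \<gamma>_def le_less_trans)
  define K where "K = \<gamma> / c"
  have \<gamma>0: "0 \<le> \<gamma>" by (simp add: \<gamma>_def)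
  have K0: "0 \<le> K" using c by (simp add: K_def \<gamma>_def)
  define F where "F k x = max (- real k) (min (real k) (f x))" for k x
  have Fm [measurable]: "F k \<in> borel_measurable \<mu>" for k unfolding F_def by measurable
  have FB: "\<bar>F k x\<bar> \<le> real k" for k x by (auto simp: F_def)
  have Ff: "\<bar>F k x\<bar> \<le> \<bar>f x\<bar>" for k x by (auto simp: F_def)
  have F_eq: "F k x = f x" if "\<bar>f x\<bar> \<le> real k" for k x using that by (auto simp: F_def)
  have var: "c * real_variance \<mu> (F k) \<le> \<gamma>" for k
  proof -
    have "ennreal (c * real_variance \<mu> (F k)) \<le> (\<integral>\<^sup>+x. (grad_minus m (F k) x)\<^sup>2 \<partial>\<mu>)"
    proof (rule bounded)
      show "\<bar>F k x - F k y\<bar> \<le> L * mdist m x y" if "x \<in> mspace m" "y \<in> mspace m" for x y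
        using lip[OF that] by (auto simp: F_def)
    qed (use L FB in auto)
    also have "\<dots> \<le> ennreal \<gamma>"
      unfolding \<Gamma>[symmetric] \<Gamma>_def
      by (intro nn_integral_mono power_mono grad_minus_mono) (auto simp: F_def)
    finally show ?thesis using \<gamma>0 by (simp add: ennreal_le_iff)
  qed
  then have varK: "real_variance \<mu> (F k) \<le> K" for k
    using c by (simp add: K_def pos_le_divide_eq mult.commute)
  obtain N :: nat where N: "1 / 2 < prob {x\<in>space \<mu>. \<bar>f x\<bar> \<le> real N}"
  proof -
    have "(\<lambda>n. prob {x\<in>space \<mu>. \<bar>f x\<bar> \<le> real n}) \<longlonglongrightarrow> prob (\<Union>n. {x\<in>space \<mu>. \<bar>f x\<bar> \<le> real n})"
    proof (rule finite_Lim_measure_incseq)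
      have "{x\<in>space \<mu>. \<bar>f x\<bar> \<le> real n} \<in> sets \<mu>" for n by measurable
      then show "range (\<lambda>n. {x\<in>space \<mu>. \<bar>f x\<bar> \<le> real n}) \<subseteq> sets \<mu>" by blast
    qed (auto simp: incseq_def)
    also have "(\<Union>n. {x\<in>space \<mu>. \<bar>f x\<bar> \<le> real n}) = space \<mu>"
      by (auto intro: real_arch_simple)
    finally have "(\<lambda>n. prob {x\<in>space \<mu>. \<bar>f x\<bar> \<le> real n}) \<longlonglongrightarrow> 1" by (simp only: prob_space)
    then have "\<forall>\<^sub>F n in sequentially. 1 / 2 < prob {x\<in>space \<mu>. \<bar>f x\<bar> \<le> real n}"
      by (rule order_tendstoD(1)) simp
    with that show ?thesis by (auto simp: eventually_sequentially)
  qed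
  define Q where "Q = K + (real N + sqrt (2 * K))\<^sup>2"
  have second: "(\<integral>x. (F k x)\<^sup>2 \<partial>\<mu>) \<le> Q" if k: "N \<le> k" for k
  proof -
    define e where "e = expectation (F k)"
    have "\<bar>e\<bar> \<le> real N + sqrt (2 * K)"
    proof (cases "\<bar>e\<bar> \<le> real N")
      case True
      then show ?thesis using K0 by (simp add: add_increasing2)
    next
      case False
      have "1 / 2 * (\<bar>e\<bar> - real N)\<^sup>2 \<le> prob {x\<in>space \<mu>. \<bar>f x\<bar> \<le> real N} * (\<bar>e\<bar> - real N)\<^sup>2"
        using N by (intro mult_right_mono) auto
      also have "\<dots> = (\<integral>x. indicator {x\<in>space \<mu>. \<bar>f x\<bar> \<le> real N} x * (\<bar>e\<bar> - real N)\<^sup>2 \<partial>\<mu>)"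
        by (subst integral_mult_left_zero) (auto intro!: arg_cong[where f = prob])
      also have "\<dots> \<le> (\<integral>x. (F k x - e)\<^sup>2 \<partial>\<mu>)"
      proof (rule integral_mono)
        show "integrable \<mu> (\<lambda>x. indicator {x\<in>space \<mu>. \<bar>f x\<bar> \<le> real N} x * (\<bar>e\<bar> - real N)\<^sup>2)"
          by (rule integrable_bounded[where B = "(\<bar>e\<bar> - real N)\<^sup>2"])
            (measurable, simp add: indicator_def)
        show "integrable \<mu> (\<lambda>x. (F k x - e)\<^sup>2)"
        proof (rule integrable_bounded)
          show "\<bar>(F k x - e)\<^sup>2\<bar> \<le> (2 * real k)\<^sup>2" for x
            using FB[of k x] abs_integral_bounded[where h = "F k", OF prob_space_axioms FB]
            unfolding e_def by (intro abs_power2_le) linarith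
        qed measurable
        show "indicator {x\<in>space \<mu>. \<bar>f x\<bar> \<le> real N} x * (\<bar>e\<bar> - real N)\<^sup>2 \<le> (F k x - e)\<^sup>2"
          if "x \<in> space \<mu>" for x
        proof (cases "\<bar>f x\<bar> \<le> real N")
          case True
          then have "F k x = f x" using k by (intro F_eq) simp
          with True False have "\<bar>\<bar>e\<bar> - real N\<bar> \<le> \<bar>F k x - e\<bar>" by linarith
          then have "(\<bar>e\<bar> - real N)\<^sup>2 \<le> (F k x - e)\<^sup>2" by (simp add: abs_le_square_iff)
          then show ?thesis by (auto simp: indicator_def)
        qed simp
      qed
      also have "\<dots> = real_variance \<mu> (F k)" unfolding e_def by (rule real_variance_eq[OF Fm FB, symmetric])
      also have "\<dots> \<le> K" by (rule varK)
      finally have "\<bar>e\<bar> - real N \<le> sqrt (2 * K)" by (intro real_le_rsqrt) simp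
      then show ?thesis by simp
    qed
    then have "\<bar>e\<^sup>2\<bar> \<le> (real N + sqrt (2 * K))\<^sup>2" by (rule abs_power2_le)
    with varK[of k] show ?thesis by (simp add: Q_def real_variance_def e_def)
  qed
  have "(\<integral>\<^sup>+x. ennreal ((f x)\<^sup>2) \<partial>\<mu>) = (\<integral>\<^sup>+x. liminf (\<lambda>k. ennreal ((F k x)\<^sup>2)) \<partial>\<mu>)"
  proof (rule nn_integral_cong)
    fix x
    obtain k0 :: nat where k0: "\<bar>f x\<bar> \<le> real k0" using real_arch_simple by blast
    have "\<forall>\<^sub>F k in sequentially. ennreal ((F k x)\<^sup>2) = ennreal ((f x)\<^sup>2)"
      using eventually_ge_at_top[of k0] by eventually_elim (use k0 F_eq in simp)
    from tendsto_eventually[OF this] show "ennreal ((f x)\<^sup>2) = liminf (\<lambda>k. ennreal ((F k x)\<^sup>2))"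
      by (intro lim_imp_Liminf[symmetric]) auto
  qed
  also have "\<dots> \<le> liminf (\<lambda>k. \<integral>\<^sup>+x. ennreal ((F k x)\<^sup>2) \<partial>\<mu>)" by (rule nn_integral_liminf) measurable
  also have "\<dots> \<le> liminf (\<lambda>k::nat. ennreal Q)"
  proof (rule Liminf_mono)
    show "\<forall>\<^sub>F k in sequentially. (\<integral>\<^sup>+x. ennreal ((F k x)\<^sup>2) \<partial>\<mu>) \<le> ennreal Q"
      using eventually_ge_at_top[of N]
    proof eventually_elim
      case (elim k)
      have "integrable \<mu> (\<lambda>x. (F k x)\<^sup>2)"
        by (rule integrable_bounded[OF _ abs_power2_le[OF FB]]) measurable
      then show ?case using second[OF elim] by (simp add: nn_integral_eq_integral ennreal_leI)
    qed
  qed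
  also have "\<dots> = ennreal Q" by (simp add: Liminf_const)
  finally have "(\<integral>\<^sup>+x. ennreal ((f x)\<^sup>2) \<partial>\<mu>) < \<infinity>" by (simp add: le_less_trans)
  then have f2: "integrable \<mu> (\<lambda>x. (f x)\<^sup>2)" by (intro integrableI_nonneg) auto
  then have f1: "integrable \<mu> f" by (rule square_integrable_imp_integrable[OF fm])
  have lim: "(\<lambda>k. F k x) \<longlonglongrightarrow> f x" for x
  proof -
    obtain k0 :: nat where k0: "\<bar>f x\<bar> \<le> real k0" using real_arch_simple by blast
    have "\<forall>\<^sub>F k in sequentially. F k x = f x"
      using eventually_ge_at_top[of k0] by eventually_elim (use k0 F_eq in simp)
    then show ?thesis by (rule tendsto_eventually)
  qed
  have "(\<lambda>k. \<integral>x. F k x \<partial>\<mu>) \<longlonglongrightarrow> (\<integral>x. f x \<partial>\<mu>)"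
    by (rule integral_dominated_convergence[where w = "\<lambda>x. \<bar>f x\<bar>"]) (use f1 lim Ff in auto)
  moreover have "(\<lambda>k. \<integral>x. (F k x)\<^sup>2 \<partial>\<mu>) \<longlonglongrightarrow> (\<integral>x. (f x)\<^sup>2 \<partial>\<mu>)"
  proof (rule integral_dominated_convergence[where w = "\<lambda>x. (f x)\<^sup>2"])
    show "AE x in \<mu>. norm ((F k x)\<^sup>2) \<le> (f x)\<^sup>2" for k
      using Ff by (intro AE_I2) (simp add: abs_le_square_iff[symmetric])
    show "AE x in \<mu>. (\<lambda>k. (F k x)\<^sup>2) \<longlonglongrightarrow> (f x)\<^sup>2"
      by (intro AE_I2 tendsto_power lim)
  qed (use f2 in auto)
  ultimately have "(\<lambda>k. c * real_variance \<mu> (F k)) \<longlonglongrightarrow> c * real_variance \<mu> f"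
    unfolding real_variance_def by (intro tendsto_mult tendsto_diff tendsto_const tendsto_power)
  then have le: "c * real_variance \<mu> f \<le> \<gamma>" by (rule LIMSEQ_le_const2) (use var in auto)
  have "integrable \<mu> (\<lambda>x. (f x - expectation f)\<^sup>2)"
    using f1 f2 by (simp add: power2_diff)
  then have "evariance \<mu> f = ennreal (real_variance \<mu> f)"
    using f1 f2 variance_eq[OF f1 f2] by (simp add: evariance_def nn_integral_eq_integral real_variance_def)
  then have "ennreal c * evariance \<mu> f = ennreal (c * real_variance \<mu> f)"
    using c by (simp add: ennreal_mult')
  also have "\<dots> \<le> \<Gamma>" unfolding \<Gamma> using le by (rule ennreal_leI)
  finally show "ennreal c * evariance \<mu> f \<le> (\<integral>\<^sup>+x. (grad_minus m f x)\<^sup>2 \<partial>\<mu>)" by (simp add: \<Gamma>_def)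
qed

end

section \<open>Optimal constants\<close>

context polish_prob begin

lemma poincare_if_r_infty_less:
  assumes t: "0 < t" "t < 1 / 2" and r: "r_infty m \<mu> t < ennreal r"
  shows "poincare m \<mu> (ennreal ((inv Phi_bar t / r)\<^sup>2))"
proof (rule poincare_from_bounded)
  have "r \<noteq> 0" using r by auto
  then show "0 < (inv Phi_bar t / r)\<^sup>2" using inv_Phi_bar_pos[OF t] by simp
qed (rule variance_le_integral_grad_minus[OF t r])

end

lemma poincare_antimono:
  fixes m :: "'a metric"
  assumes "poincare m \<mu> c" "c' \<le> c" shows "poincare m \<mu> c'"
  unfolding poincare_def
proof (intro allI impI)
  fix f :: "'a \<Rightarrow> real" assume f: "Lipschitz_continuous_map m euclidean_metric f"
  have "c' * evariance \<mu> f \<le> c * evariance \<mu> f" using assms(2) by (rule mult_right_mono) simp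
  also have "\<dots> \<le> (\<integral>\<^sup>+x. (grad_minus m f x)\<^sup>2 \<partial>\<mu>)" using assms(1) f by (simp add: poincare_def)
  finally show "c' * evariance \<mu> f \<le> (\<integral>\<^sup>+x. (grad_minus m f x)\<^sup>2 \<partial>\<mu>)" .
qed

text \<open>
  Multiplication in \<^typ>\<open>ennreal\<close> commutes with suprema, so the supremum of all admissible constants
  is admissible.
\<close>

lemma optimal_poincare_exists: "\<exists>c. optimal_poincare m \<mu> c"
proof -
  define c where "c = Sup {c. poincare m \<mu> c}"
  have "c * evariance \<mu> f \<le> (\<integral>\<^sup>+x. (grad_minus m f x)\<^sup>2 \<partial>\<mu>)"
    if f: "Lipschitz_continuous_map m euclidean_metric f" for f
  proof -
    have "c * evariance \<mu> f = (SUP c\<in>{c. poincare m \<mu> c}. c * evariance \<mu> f)"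
      unfolding c_def using SUP_mult_right_ennreal[of "\<lambda>c. c"] by simp
    also have "\<dots> \<le> (\<integral>\<^sup>+x. (grad_minus m f x)\<^sup>2 \<partial>\<mu>)"
      using f by (intro SUP_least) (simp add: poincare_def)
    finally show ?thesis .
  qed
  then have "poincare m \<mu> c" unfolding poincare_def by blast
  then have "optimal_poincare m \<mu> c"
    unfolding optimal_poincare_def by (auto simp: c_def intro: Sup_upper)
  then show ?thesis ..
qed

context polish_prob begin

text \<open>
  An infinite constant is the limit of finite ones: \<open>r\<close> times every finite number is at most a fixed
  finite bound, so \<open>r = 0\<close>.
\<close>

lemma r_infty_esqrt_le:
  assumes c: "0 < c" and poi: "poincare m \<mu> c" and t: "0 < t" "t < 1 / 2"
  shows "r_infty m \<mu> t * esqrt c \<le> ennreal (2 * sqrt 2 / ln 2 * ln (4 / t))"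
proof (cases "c = \<infinity>")
  case False
  then obtain c' where c': "c = ennreal c'" "0 \<le> c'" by (cases c) auto
  with c have "0 < c'" by simp
  with r_infty_le[OF poi[unfolded c'(1)] _ t] show ?thesis by (simp add: c' esqrt_def)
next
  case True
  define K where "K = 2 * sqrt 2 / ln 2 * ln (4 / t)"
  have K0: "0 \<le> K" using t by (simp add: K_def)
  have le: "r_infty m \<mu> t * ennreal k \<le> ennreal K" if k: "0 < k" for k
    using r_infty_le[OF poincare_antimono[OF poi] _ t, of "k\<^sup>2"] k True by (simp add: K_def)
  have "r_infty m \<mu> t \<noteq> \<infinity>" using le[of 1] by (auto simp: ennreal_top_mult top_unique)
  then obtain r where r: "r_infty m \<mu> t = ennreal r" "0 \<le> r" by (cases "r_infty m \<mu> t") auto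
  have "r = 0"
  proof (rule ccontr)
    assume "r \<noteq> 0"
    with r have r0: "0 < r" by simp
    have "r * ((K + 1) / r) \<le> K"
      using le[of "(K + 1) / r"] r0 r K0 by (simp add: ennreal_mult'[symmetric])
    with r0 show False by simp
  qed
  then show ?thesis by (simp add: r)
qed

text \<open>
  Optimality is used in the form \<open>(q / r')\<^sup>2 \<le> c\<close> for every \<open>r'\<close> above \<open>r_infty m \<mu> t\<close>.
\<close>

lemma inv_Phi_bar_le_r_infty:
  assumes opt: "optimal_poincare m \<mu> c" and c: "0 < c" "c \<noteq> \<infinity>" and t: "0 < t" "t < 1 / 2"
  shows "ennreal (inv Phi_bar t) \<le> r_infty m \<mu> t * esqrt c"
proof -
  define q where "q = inv Phi_bar t"
  have q: "q > 0" unfolding q_def by (rule inv_Phi_bar_pos[OF t])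
  obtain c' where c': "c = ennreal c'" "0 \<le> c'" using c by (cases c) auto
  with c have c0: "0 < c'" by simp
  have es: "esqrt c = ennreal (sqrt c')" using c' by (simp add: esqrt_def)
  show ?thesis
  proof (cases "r_infty m \<mu> t = \<infinity>")
    case True
    then show ?thesis using c0 by (simp add: es ennreal_top_mult)
  next
    case False
    then obtain r where r: "r_infty m \<mu> t = ennreal r" "0 \<le> r" by (cases "r_infty m \<mu> t") auto
    have "q / sqrt c' \<le> r"
    proof (rule field_le_epsilon)
      fix \<epsilon> :: real assume \<epsilon>: "\<epsilon> > 0"
      have "poincare m \<mu> (ennreal ((q / (r + \<epsilon>))\<^sup>2))"
        unfolding q_def using r \<epsilon> by (intro poincare_if_r_infty_less[OF t]) (simp add: ennreal_lessI)
      then have "ennreal ((q / (r + \<epsilon>))\<^sup>2) \<le> ennreal c'"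
        using opt by (simp add: optimal_poincare_def c')
      then have "(q / (r + \<epsilon>))\<^sup>2 \<le> c'" using c' by (simp add: ennreal_le_iff)
      then have "q / (r + \<epsilon>) \<le> sqrt c'" by (rule real_le_rsqrt)
      then show "q / sqrt c' \<le> r + \<epsilon>" using r \<epsilon> c0 by (simp add: field_simps)
    qed
    then have "q \<le> r * sqrt c'" using c0 by (simp add: field_simps)
    then show ?thesis using r c0 by (simp add: es q_def ennreal_mult[symmetric] ennreal_leI)
  qed
qed

lemma optimal_poincare_iff:
  "(\<exists>c>0. optimal_poincare m \<mu> c) \<longleftrightarrow> (\<exists>t\<in>{0<..<1/2}. r_infty m \<mu> t < \<infinity>)"
proof
  assume "\<exists>c>0. optimal_poincare m \<mu> c"
  then obtain c where c: "0 < c" "poincare m \<mu> c" by (auto simp: optimal_poincare_def)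
  have "esqrt c \<noteq> 0" using c(1) by (cases c) (auto simp: esqrt_def)
  moreover have "r_infty m \<mu> (1 / 4) * esqrt c \<le> ennreal (2 * sqrt 2 / ln 2 * ln (4 / (1 / 4)))"
    by (rule r_infty_esqrt_le[OF c]) auto
  ultimately have "r_infty m \<mu> (1 / 4) < \<infinity>"
    by (cases "r_infty m \<mu> (1 / 4) = \<top>") (auto simp: ennreal_top_mult top_unique less_top)
  then show "\<exists>t\<in>{0<..<1/2}. r_infty m \<mu> t < \<infinity>" by (intro bexI[of _ "1 / 4"]) auto
next
  assume "\<exists>t\<in>{0<..<1/2}. r_infty m \<mu> t < \<infinity>"
  then obtain t where t: "0 < t" "t < 1 / 2" and "r_infty m \<mu> t < \<infinity>" by auto
  then obtain r where r: "r_infty m \<mu> t = ennreal r" "0 \<le> r" by (cases "r_infty m \<mu> t") auto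
  have poi: "poincare m \<mu> (ennreal ((inv Phi_bar t / (r + 1))\<^sup>2))"
    using r by (intro poincare_if_r_infty_less[OF t]) (simp add: ennreal_lessI)
  obtain c where c: "optimal_poincare m \<mu> c" using optimal_poincare_exists by blast
  with poi have "ennreal ((inv Phi_bar t / (r + 1))\<^sup>2) \<le> c" by (simp add: optimal_poincare_def)
  moreover have "0 < ennreal ((inv Phi_bar t / (r + 1))\<^sup>2)"
    using inv_Phi_bar_pos[OF t] r by simp
  ultimately have "0 < c" by (rule less_le_trans[rotated])
  with c show "\<exists>c>0. optimal_poincare m \<mu> c" by blast
qed

end

theorem corollary1p14:
  shows "\<exists>a b :: real. a > 0 \<and> b \<ge> 1 \<and>
    (\<forall>(m :: 'a metric) (\<mu> :: 'a measure).
       polish_metric m \<and> borel_prob_measure m \<mu> \<longrightarrow>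
         ((\<exists>c>0. optimal_poincare m \<mu> c) \<longleftrightarrow> (\<exists>t\<in>{0<..<1/2}. r_infty m \<mu> t < \<infinity>)) \<and>
         (\<forall>c>0. optimal_poincare m \<mu> c \<longrightarrow>
            (\<forall>t\<in>{0<..<1/2}.
               (c \<noteq> \<infinity> \<longrightarrow> ennreal (inv Phi_bar t) \<le> r_infty m \<mu> t * esqrt c) \<and>
               r_infty m \<mu> t * esqrt c \<le> ennreal (a * ln (b / t)))))"
proof (intro exI conjI allI impI)
  show "0 < 2 * sqrt 2 / ln (2 :: real)" "(1 :: real) \<le> 4" by simp_all
  fix m :: "'a metric" and \<mu> :: "'a measure"
  assume "polish_metric m \<and> borel_prob_measure m \<mu>"
  then interpret polish_prob m \<mu> by unfold_locales auto
  show "(\<exists>c>0. optimal_poincare m \<mu> c) \<longleftrightarrow> (\<exists>t\<in>{0<..<1/2}. r_infty m \<mu> t < \<infinity>)"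
    by (rule optimal_poincare_iff)
  fix c assume c: "0 < c" "optimal_poincare m \<mu> c"
  show "\<forall>t\<in>{0<..<1/2}. (c \<noteq> \<infinity> \<longrightarrow> ennreal (inv Phi_bar t) \<le> r_infty m \<mu> t * esqrt c) \<and>
      r_infty m \<mu> t * esqrt c \<le> ennreal (2 * sqrt 2 / ln 2 * ln (4 / t))"
    using c inv_Phi_bar_le_r_infty[OF c(2,1)] r_infty_esqrt_le[OF c(1)]
    by (auto simp: optimal_poincare_def)
qed

end
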